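(* Let $\mathcal{C}$ be a finitely complete category. Let $i_V\colon \partial V \to V$, $i_L\colon \partial L \to L$, $p\colon E \to \underline{E}$ and $\ell\colon L \to L'$ be maps in $\mathcal{C}$, where $\partial V, V, \partial L, L, L'$ are exponentiable objects. Suppose that a map $k\colon \partial(V\times L) \to V\times L$ structurally approximates the pushout-product $(\partial V\to V)\ltimes(\partial L\to L)$ relative to $p\colon E\to\underline{E}$. Then there is a bijection $$\mathrm{Lift}_{\mathrm{L}}\bigl(k,\ V\times \ell;\ p\bigr)\;\cong\;\mathrm{Lift}_{\mathrm{R}}\bigl(i_V;\ \widehat{p},\ q\bigr),$$ where $\widehat{p}\colon [L,E]\to [\partial L,E]\times_{[\partial L,\underline{E}]}[L,\underline{E}]$ is the pullback-power (pullback-Hom) of $i_L$ with $p$, and $q\colon [\partial L,E]\times_{[\partial L,\underline{E}]}[L',\underline{E}]\to[\partial L,E]\times_{[\partial L,\underline{E}]}[L,\underline{E}]$ is the map induced by $\ell\colon L\to L'$. (Here the map $[L',\underline E]\to[\partial L,\underline E]$ is restriction along $\ell i_L$.)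
   Context: An object $A$ of a finitely complete category $\mathcal C$ is exponentiable if $-\times A$ has a right adjoint, written $[A,-]$. Left-restricted lifting structures. Given maps $i\colon U\to V$, $j\colon V\to V'$, $p\colon E\to B$, a lifting problem at $X\in\mathcal C$ of $i$ against $p$ left-restricted along $j$ is a pair $(u\colon X\times U\to E,\ v'\colon X\times V'\to B)$ with $p u = v'\,(X\times j)(X\times i)$. A solution is a map $f\colon X\times V\to E$ with $f\,(X\times i)=u$ and $p f=v'\,(X\times j)$. A (uniform) lifting structure is a choice of solution $F_X(u,v')$ for every $X$ and every such $(u,v')$, such that $F_Y(u(t\times U),v'(t\times V'))=F_X(u,v')(t\times V)$ for all $t\colon Y\to X$. The set of these is $\mathrm{Lift}_{\mathrm L}(i,j;p)$. Right-restricted lifting structures. Given $i\colon U\to V$, $p\colon E\to B$, $q\colon B'\to B$, a lifting problem at $X$ of $i$ against $p$ right-restricted along $q$ is a pair $(u\colon X\times U\to E,\ v\colon X\times V\to B')$ with $pu=q v (X\times i)$. A solution is $f\colon X\times V\to E$ with $f(X\times i)=u$, $pf=qv$. A (uniform) lifting structure is a choice of solutions $F_X(u,v)$ with $F_Y(u(t\times U),v(t\times V))=F_X(u,v)(t\times V)$ for all $t\colon Y\to X$. The set of these is $\mathrm{Lift}_{\mathrm R}(i;p,q)$. Pushout-product approximation. Let $i_V\colon\partial V\to V$, $i_L\colon\partial L\to L$ be maps between exponentiable objects and $p\colon E\to B$ a map. For an object $X$ put $M_X:=[\partial V\times L,X]\times_{[\partial V\times\partial L,X]}[V\times\partial L,X]$.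 Let $k\colon\partial(V\times L)\to V\times L$ be a map, where $\partial(V\times L)$ is just the name of some exponentiable object. A $(\partial V\to V)\ltimes(\partial L\to L)$-approximation structure on $k$ relative to $p$ consists of isomorphisms $s_E\colon M_E\cong[\partial(V\times L),E]$ and $s_B\colon M_B\cong[\partial(V\times L),B]$ such that (1) $[\partial(V\times L),p]\circ s_E=s_B\circ M_p$, where $M_p\colon M_E\to M_B$ is induced by post-composition with $p$; and (2) the composite of the canonical restriction map $[V\times L,B]\to M_B$ with $s_B$ equals $[k,B]\colon[V\times L,B]\to[\partial(V\times L),B]$. The map $k$ "structurally approximates" the pushout-product relative to $p$ when it is equipped with such a structure.
   Formalization: Condition (2) of the approximation structure is also assumed at E: the restriction map [V×L,E]→M_E followed by s_E equals [k,E]. With (2) only at the codomain of p the claim fails, e.g. in finite sets with ∂V=0, V=1, i_L=ℓ=id on 2, p:2→1, k:2→2 constant. *)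

theory Defs
  imports Main
begin

section \<open>Categories, functors, adjunctions, finite limits\<close>

record ('o, 'm) category =
  Ob :: "'o set"
  Arr :: "'m set"
  Dom :: "'m \<Rightarrow> 'o"
  Cod :: "'m \<Rightarrow> 'o"
  Ident :: "'o \<Rightarrow> 'm"  ("\<one>\<index>")
  Comp :: "'m \<Rightarrow> 'm \<Rightarrow> 'm"  (infixl "\<cdot>\<index>" 70)

definition hom :: "('o, 'm) category \<Rightarrow> 'o \<Rightarrow> 'o \<Rightarrow> 'm set" where
  "hom C X Y = {f \<in> Arr C. Dom C f = X \<and> Cod C f = Y}"

locale category =
  fixes C :: "('o, 'm) category" (structure)
  assumes Dom_Ob: "f \<in> Arr C \<Longrightarrow> Dom C f \<in> Ob C"
    and Cod_Ob: "f \<in> Arr C \<Longrightarrow> Cod C f \<in> Ob C"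
    and Ident_hom: "X \<in> Ob C \<Longrightarrow> \<one> X \<in> hom C X X"
    and Comp_hom: "f \<in> hom C X Y \<Longrightarrow> g \<in> hom C Y Z \<Longrightarrow> g \<cdot> f \<in> hom C X Z"
    and Comp_Ident: "f \<in> hom C X Y \<Longrightarrow> f \<cdot> \<one> X = f"
    and Ident_Comp: "f \<in> hom C X Y \<Longrightarrow> \<one> Y \<cdot> f = f"
    and Comp_assoc: "f \<in> hom C W X \<Longrightarrow> g \<in> hom C X Y \<Longrightarrow> h \<in> hom C Y Z \<Longrightarrow>
      (h \<cdot> g) \<cdot> f = h \<cdot> (g \<cdot> f)"

definition is_functor ::
  "('o, 'm) category \<Rightarrow> ('p, 'n) category \<Rightarrow> ('o \<Rightarrow> 'p) \<Rightarrow> ('m \<Rightarrow> 'n) \<Rightarrow> bool" where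
  "is_functor C D Fo Fa \<longleftrightarrow>
     (\<forall>X \<in> Ob C. Fo X \<in> Ob D) \<and>
     (\<forall>X Y. \<forall>f \<in> hom C X Y. Fa f \<in> hom D (Fo X) (Fo Y)) \<and>
     (\<forall>X \<in> Ob C. Fa (\<one>\<^bsub>C\<^esub> X) = \<one>\<^bsub>D\<^esub> (Fo X)) \<and>
     (\<forall>X Y Z. \<forall>f \<in> hom C X Y. \<forall>g \<in> hom C Y Z. Fa (g \<cdot>\<^bsub>C\<^esub> f) = Fa g \<cdot>\<^bsub>D\<^esub> Fa f)"

definition adjunction ::
  "('o, 'm) category \<Rightarrow> ('p, 'n) category \<Rightarrow> ('o \<Rightarrow> 'p) \<Rightarrow> ('m \<Rightarrow> 'n) \<Rightarrow>
   ('p \<Rightarrow> 'o) \<Rightarrow> ('n \<Rightarrow> 'm) \<Rightarrow> ('o \<Rightarrow> 'p \<Rightarrow> 'n \<Rightarrow> 'm) \<Rightarrow> bool" where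
  "adjunction C D Fo Fa Go Ga \<phi> \<longleftrightarrow>
     is_functor C D Fo Fa \<and> is_functor D C Go Ga \<and>
     (\<forall>X \<in> Ob C. \<forall>Y \<in> Ob D. bij_betw (\<phi> X Y) (hom D (Fo X) Y) (hom C X (Go Y))) \<and>
     (\<forall>X X' Y Y'. \<forall>h \<in> hom C X' X. \<forall>g \<in> hom D Y Y'. \<forall>f \<in> hom D (Fo X) Y.
        \<phi> X' Y' (g \<cdot>\<^bsub>D\<^esub> f \<cdot>\<^bsub>D\<^esub> Fa h) = Ga g \<cdot>\<^bsub>C\<^esub> \<phi> X Y f \<cdot>\<^bsub>C\<^esub> h)"

definition is_cone ::
  "('j, 'i) category \<Rightarrow> ('o, 'm) category \<Rightarrow> ('j \<Rightarrow> 'o) \<Rightarrow> ('i \<Rightarrow> 'm) \<Rightarrow> 'o \<Rightarrow> ('j \<Rightarrow> 'm) \<Rightarrow> bool"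
  where
  "is_cone J C Do Da N \<psi> \<longleftrightarrow>
     N \<in> Ob C \<and> (\<forall>j \<in> Ob J. \<psi> j \<in> hom C N (Do j)) \<and>
     (\<forall>j j'. \<forall>a \<in> hom J j j'. Da a \<cdot>\<^bsub>C\<^esub> \<psi> j = \<psi> j')"

definition is_limit ::
  "('j, 'i) category \<Rightarrow> ('o, 'm) category \<Rightarrow> ('j \<Rightarrow> 'o) \<Rightarrow> ('i \<Rightarrow> 'm) \<Rightarrow> 'o \<Rightarrow> ('j \<Rightarrow> 'm) \<Rightarrow> bool"
  where
  "is_limit J C Do Da N \<psi> \<longleftrightarrow>
     is_cone J C Do Da N \<psi> \<and>
     (\<forall>N' \<psi>'. is_cone J C Do Da N' \<psi>' \<longrightarrow>
        (\<exists>!h. h \<in> hom C N' N \<and> (\<forall>j \<in> Ob J. \<psi> j \<cdot>\<^bsub>C\<^esub> h = \<psi>' j)))"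

text \<open>Every finite category is isomorphic to one whose objects and arrows are natural numbers,
  so it suffices to let the shape \<open>J\<close> range over those.\<close>

definition finitely_complete :: "('o, 'm) category \<Rightarrow> bool" where
  "finitely_complete C \<longleftrightarrow>
     (\<forall>(J :: (nat, nat) category) Do Da.
        category J \<and> finite (Ob J) \<and> finite (Arr J) \<and> is_functor J C Do Da \<longrightarrow>
        (\<exists>N \<psi>. is_limit J C Do Da N \<psi>))"

text \<open>Products, pullbacks and right adjoints are determined up to isomorphism only. As usual, the
  notation refers to a choice, made below with \<open>SOME\<close>; it is meaningful when the object in question
  exists.\<close>

context
  fixes C :: "('o, 'm) category" (structure)
begin

definition is_iso :: "'o \<Rightarrow> 'o \<Rightarrow> 'm \<Rightarrow> bool" where
  "is_iso X Y f \<longleftrightarrow> f \<in> hom C X Y \<and> (\<exists>g \<in> hom C Y X. g \<cdot> f = \<one> X \<and> f \<cdot> g = \<one> Y)"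

subsection \<open>Binary products\<close>

definition is_product :: "'o \<Rightarrow> 'o \<Rightarrow> 'o \<Rightarrow> 'm \<Rightarrow> 'm \<Rightarrow> bool" where
  "is_product X Y P a b \<longleftrightarrow>
     a \<in> hom C P X \<and> b \<in> hom C P Y \<and>
     (\<forall>Z f g. f \<in> hom C Z X \<and> g \<in> hom C Z Y \<longrightarrow>
        (\<exists>!h. h \<in> hom C Z P \<and> a \<cdot> h = f \<and> b \<cdot> h = g))"

definition prod_cone :: "'o \<Rightarrow> 'o \<Rightarrow> 'o \<times> 'm \<times> 'm" where
  "prod_cone X Y = (SOME c. case c of (P, a, b) \<Rightarrow> is_product X Y P a b)"

definition prod_ob :: "'o \<Rightarrow> 'o \<Rightarrow> 'o"  (infixr "\<times>\<^sub>o" 80) where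
  "X \<times>\<^sub>o Y = fst (prod_cone X Y)"

definition proj1 :: "'o \<Rightarrow> 'o \<Rightarrow> 'm" where
  "proj1 X Y = fst (snd (prod_cone X Y))"

definition proj2 :: "'o \<Rightarrow> 'o \<Rightarrow> 'm" where
  "proj2 X Y = snd (snd (prod_cone X Y))"

definition pairing :: "'m \<Rightarrow> 'm \<Rightarrow> 'm" where
  "pairing f g = (THE h. h \<in> hom C (Dom C f) (Cod C f \<times>\<^sub>o Cod C g) \<and>
     proj1 (Cod C f) (Cod C g) \<cdot> h = f \<and> proj2 (Cod C f) (Cod C g) \<cdot> h = g)"

definition prod_map :: "'m \<Rightarrow> 'm \<Rightarrow> 'm"  (infixr "\<times>\<^sub>a" 80) where
  "f \<times>\<^sub>a g = pairing (f \<cdot> proj1 (Dom C f) (Dom C g)) (g \<cdot> proj2 (Dom C f) (Dom C g))"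

subsection \<open>Pullbacks\<close>

definition is_pullback :: "'m \<Rightarrow> 'm \<Rightarrow> 'o \<Rightarrow> 'm \<Rightarrow> 'm \<Rightarrow> bool" where
  "is_pullback f g P a b \<longleftrightarrow>
     a \<in> hom C P (Dom C f) \<and> b \<in> hom C P (Dom C g) \<and> f \<cdot> a = g \<cdot> b \<and>
     (\<forall>Z x y. x \<in> hom C Z (Dom C f) \<and> y \<in> hom C Z (Dom C g) \<and> f \<cdot> x = g \<cdot> y \<longrightarrow>
        (\<exists>!h. h \<in> hom C Z P \<and> a \<cdot> h = x \<and> b \<cdot> h = y))"

definition pb_cone :: "'m \<Rightarrow> 'm \<Rightarrow> 'o \<times> 'm \<times> 'm" where
  "pb_cone f g = (SOME c. case c of (P, a, b) \<Rightarrow> is_pullback f g P a b)"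

definition pb_ob :: "'m \<Rightarrow> 'm \<Rightarrow> 'o" where
  "pb_ob f g = fst (pb_cone f g)"

definition pb_proj1 :: "'m \<Rightarrow> 'm \<Rightarrow> 'm" where
  "pb_proj1 f g = fst (snd (pb_cone f g))"

definition pb_proj2 :: "'m \<Rightarrow> 'm \<Rightarrow> 'm" where
  "pb_proj2 f g = snd (snd (pb_cone f g))"

definition pb_pairing :: "'m \<Rightarrow> 'm \<Rightarrow> 'm \<Rightarrow> 'm \<Rightarrow> 'm" where
  "pb_pairing f g x y = (THE h. h \<in> hom C (Dom C x) (pb_ob f g) \<and>
     pb_proj1 f g \<cdot> h = x \<and> pb_proj2 f g \<cdot> h = y)"

subsection \<open>Exponentials\<close>

definition is_exponential :: "'o \<Rightarrow> ('o \<Rightarrow> 'o) \<Rightarrow> ('m \<Rightarrow> 'm) \<Rightarrow> ('o \<Rightarrow> 'o \<Rightarrow> 'm \<Rightarrow> 'm) \<Rightarrow> bool" where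
  "is_exponential A Go Ga \<phi> \<longleftrightarrow>
     adjunction C C (\<lambda>X. X \<times>\<^sub>o A) (\<lambda>f. f \<times>\<^sub>a \<one> A) Go Ga \<phi>"

definition exponentiable :: "'o \<Rightarrow> bool" where
  "exponentiable A \<longleftrightarrow> A \<in> Ob C \<and> (\<exists>Go Ga \<phi>. is_exponential A Go Ga \<phi>)"

definition exp_adj :: "'o \<Rightarrow> ('o \<Rightarrow> 'o) \<times> ('m \<Rightarrow> 'm) \<times> ('o \<Rightarrow> 'o \<Rightarrow> 'm \<Rightarrow> 'm)" where
  "exp_adj A = (SOME G. case G of (Go, Ga, \<phi>) \<Rightarrow> is_exponential A Go Ga \<phi>)"

definition exp_ob :: "'o \<Rightarrow> 'o \<Rightarrow> 'o" where
  "exp_ob A = fst (exp_adj A)"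

text \<open>\<open>exp_map A f\<close> is \<open>[A, f]\<close> and \<open>exp_restrict a X\<close> is \<open>[a, X]\<close>.\<close>

definition exp_map :: "'o \<Rightarrow> 'm \<Rightarrow> 'm" where
  "exp_map A = fst (snd (exp_adj A))"

definition exp_transpose :: "'o \<Rightarrow> 'o \<Rightarrow> 'o \<Rightarrow> 'm \<Rightarrow> 'm" where
  "exp_transpose A = snd (snd (exp_adj A))"

definition eval_map :: "'o \<Rightarrow> 'o \<Rightarrow> 'm" where
  "eval_map A X =
     inv_into (hom C (exp_ob A X \<times>\<^sub>o A) X) (exp_transpose A (exp_ob A X) X) (\<one> (exp_ob A X))"

definition exp_restrict :: "'m \<Rightarrow> 'o \<Rightarrow> 'm" where
  "exp_restrict a X = exp_transpose (Dom C a) (exp_ob (Cod C a) X) X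
     (eval_map (Cod C a) X \<cdot> (\<one> (exp_ob (Cod C a) X) \<times>\<^sub>a a))"

section \<open>Restricted lifting structures\<close>

definition left_problem :: "'m \<Rightarrow> 'm \<Rightarrow> 'm \<Rightarrow> 'o \<Rightarrow> 'm \<Rightarrow> 'm \<Rightarrow> bool" where
  "left_problem i j p X u v' \<longleftrightarrow>
     X \<in> Ob C \<and> u \<in> hom C (X \<times>\<^sub>o Dom C i) (Dom C p) \<and> v' \<in> hom C (X \<times>\<^sub>o Cod C j) (Cod C p) \<and>
     p \<cdot> u = v' \<cdot> (\<one> X \<times>\<^sub>a j) \<cdot> (\<one> X \<times>\<^sub>a i)"

definition left_solution :: "'m \<Rightarrow> 'm \<Rightarrow> 'm \<Rightarrow> 'o \<Rightarrow> 'm \<Rightarrow> 'm \<Rightarrow> 'm \<Rightarrow> bool" where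
  "left_solution i j p X u v' f \<longleftrightarrow>
     f \<in> hom C (X \<times>\<^sub>o Cod C i) (Dom C p) \<and> f \<cdot> (\<one> X \<times>\<^sub>a i) = u \<and> p \<cdot> f = v' \<cdot> (\<one> X \<times>\<^sub>a j)"

text \<open>A lifting structure is a function defined on lifting problems only. Its value elsewhere is
  fixed to \<open>undefined\<close>, so that different elements of the sets below are different structures.\<close>

definition Lift_L :: "'m \<Rightarrow> 'm \<Rightarrow> 'm \<Rightarrow> ('o \<Rightarrow> 'm \<Rightarrow> 'm \<Rightarrow> 'm) set" where
  "Lift_L i j p = {F.
     (\<forall>X u v'. left_problem i j p X u v' \<longrightarrow> left_solution i j p X u v' (F X u v')) \<and>
     (\<forall>X u v'. \<not> left_problem i j p X u v' \<longrightarrow> F X u v' = undefined) \<and>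
     (\<forall>X Y u v' t. left_problem i j p X u v' \<and> t \<in> hom C Y X \<longrightarrow>
        F Y (u \<cdot> (t \<times>\<^sub>a \<one> (Dom C i))) (v' \<cdot> (t \<times>\<^sub>a \<one> (Cod C j))) =
        F X u v' \<cdot> (t \<times>\<^sub>a \<one> (Cod C i)))}"

definition right_problem :: "'m \<Rightarrow> 'm \<Rightarrow> 'm \<Rightarrow> 'o \<Rightarrow> 'm \<Rightarrow> 'm \<Rightarrow> bool" where
  "right_problem i p q X u v \<longleftrightarrow>
     X \<in> Ob C \<and> u \<in> hom C (X \<times>\<^sub>o Dom C i) (Dom C p) \<and> v \<in> hom C (X \<times>\<^sub>o Cod C i) (Dom C q) \<and>
     p \<cdot> u = q \<cdot> v \<cdot> (\<one> X \<times>\<^sub>a i)"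

definition right_solution :: "'m \<Rightarrow> 'm \<Rightarrow> 'm \<Rightarrow> 'o \<Rightarrow> 'm \<Rightarrow> 'm \<Rightarrow> 'm \<Rightarrow> bool" where
  "right_solution i p q X u v f \<longleftrightarrow>
     f \<in> hom C (X \<times>\<^sub>o Cod C i) (Dom C p) \<and> f \<cdot> (\<one> X \<times>\<^sub>a i) = u \<and> p \<cdot> f = q \<cdot> v"

definition Lift_R :: "'m \<Rightarrow> 'm \<Rightarrow> 'm \<Rightarrow> ('o \<Rightarrow> 'm \<Rightarrow> 'm \<Rightarrow> 'm) set" where
  "Lift_R i p q = {F.
     (\<forall>X u v. right_problem i p q X u v \<longrightarrow> right_solution i p q X u v (F X u v)) \<and>
     (\<forall>X u v. \<not> right_problem i p q X u v \<longrightarrow> F X u v = undefined) \<and>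
     (\<forall>X Y u v t. right_problem i p q X u v \<and> t \<in> hom C Y X \<longrightarrow>
        F Y (u \<cdot> (t \<times>\<^sub>a \<one> (Dom C i))) (v \<cdot> (t \<times>\<^sub>a \<one> (Cod C i))) =
        F X u v \<cdot> (t \<times>\<^sub>a \<one> (Cod C i)))}"

section \<open>Pullback-powers and approximations of the pushout-product\<close>

text \<open>For \<open>m : \<partial>L \<rightarrow> M\<close>, the object \<open>[\<partial>L, E] \<times> [M, B]\<close> fibred over \<open>[\<partial>L, B]\<close> is the pullback
  of \<open>exp_map \<partial>L p\<close> and \<open>exp_restrict m B\<close>. It occurs with \<open>m = i\<^sub>L\<close> and \<open>m = \<ell> \<cdot> i\<^sub>L\<close>.\<close>

definition pullback_power :: "'m \<Rightarrow> 'm \<Rightarrow> 'm" where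
  "pullback_power iL p =
     pb_pairing (exp_map (Dom C iL) p) (exp_restrict iL (Cod C p))
       (exp_restrict iL (Dom C p)) (exp_map (Cod C iL) p)"

definition power_restrict :: "'m \<Rightarrow> 'm \<Rightarrow> 'm \<Rightarrow> 'm" where
  "power_restrict iL l p =
     pb_pairing (exp_map (Dom C iL) p) (exp_restrict iL (Cod C p))
       (pb_proj1 (exp_map (Dom C iL) p) (exp_restrict (l \<cdot> iL) (Cod C p)))
       (exp_restrict l (Cod C p) \<cdot> pb_proj2 (exp_map (Dom C iL) p) (exp_restrict (l \<cdot> iL) (Cod C p)))"

text \<open>The two legs of the cospan \<open>[\<partial>V \<times> L, X] \<rightarrow> [\<partial>V \<times> \<partial>L, X] \<leftarrow> [V \<times> \<partial>L, X]\<close> defining \<open>M\<^sub>X\<close>.\<close>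

definition leg1 :: "'m \<Rightarrow> 'm \<Rightarrow> 'o \<Rightarrow> 'm" where
  "leg1 iV iL X = exp_restrict (\<one> (Dom C iV) \<times>\<^sub>a iL) X"

definition leg2 :: "'m \<Rightarrow> 'm \<Rightarrow> 'o \<Rightarrow> 'm" where
  "leg2 iV iL X = exp_restrict (iV \<times>\<^sub>a \<one> (Dom C iL)) X"

definition M_ob :: "'m \<Rightarrow> 'm \<Rightarrow> 'o \<Rightarrow> 'o" where
  "M_ob iV iL X = pb_ob (leg1 iV iL X) (leg2 iV iL X)"

definition M_map :: "'m \<Rightarrow> 'm \<Rightarrow> 'm \<Rightarrow> 'm" where
  "M_map iV iL p =
     pb_pairing (leg1 iV iL (Cod C p)) (leg2 iV iL (Cod C p))
       (exp_map (Dom C iV \<times>\<^sub>o Cod C iL) p \<cdot>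
          pb_proj1 (leg1 iV iL (Dom C p)) (leg2 iV iL (Dom C p)))
       (exp_map (Cod C iV \<times>\<^sub>o Dom C iL) p \<cdot>
          pb_proj2 (leg1 iV iL (Dom C p)) (leg2 iV iL (Dom C p)))"

definition M_restrict :: "'m \<Rightarrow> 'm \<Rightarrow> 'o \<Rightarrow> 'm" where
  "M_restrict iV iL X =
     pb_pairing (leg1 iV iL X) (leg2 iV iL X)
       (exp_restrict (iV \<times>\<^sub>a \<one> (Cod C iL)) X) (exp_restrict (\<one> (Cod C iV) \<times>\<^sub>a iL) X)"

definition approximation_structure :: "'m \<Rightarrow> 'm \<Rightarrow> 'm \<Rightarrow> 'm \<Rightarrow> 'm \<Rightarrow> 'm \<Rightarrow> bool" where
  "approximation_structure iV iL p k sE sB \<longleftrightarrow>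
     is_iso (M_ob iV iL (Dom C p)) (exp_ob (Dom C k) (Dom C p)) sE \<and>
     is_iso (M_ob iV iL (Cod C p)) (exp_ob (Dom C k) (Cod C p)) sB \<and>
     exp_map (Dom C k) p \<cdot> sE = sB \<cdot> M_map iV iL p \<and>
     sB \<cdot> M_restrict iV iL (Cod C p) = exp_restrict k (Cod C p)"

text \<open>An approximation structure constrains the restriction map only at the codomain of \<open>p\<close>. When
  \<open>p\<close> is not monic this leaves \<open>k\<close> undetermined at its domain \<open>E\<close>: if the codomain is terminal,
  the last two conditions are vacuous. The correspondence of lifting structures also needs
  \<open>sE \<cdot> M_restrict iV iL E = exp_restrict k E\<close>, which is not part of this definition.\<close>

end

end

theory Submission
  imports Defs
begin

text \<open>
  Both lifting problems are the same problem about maps out of triple products, written in two ways.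

  On the left, a map \<open>u : X \<times> K \<rightarrow> E\<close> is transposed to \<open>X \<rightarrow> [K, E]\<close> and carried along the inverse of
  \<open>s_E\<close> to a map into the pullback \<open>M_E\<close>. This amounts to a pair
  \<open>a : X \<times> (\<partial>V \<times> L) \<rightarrow> E\<close>, \<open>b : X \<times> (V \<times> \<partial>L) \<rightarrow> E\<close> that agrees on \<open>X \<times> (\<partial>V \<times> \<partial>L)\<close>, the two parts of
  \<open>u\<close> (\<open>parts_eq_iff\<close>, \<open>ex_parts\<close>). On the right, currying turns \<open>X \<times> \<partial>V \<rightarrow> [L, E]\<close> into such an
  \<open>a\<close>, and a map from \<open>X \<times> V\<close> to the domain of \<open>q\<close> into such a \<open>b\<close> with a map
  \<open>c : X \<times> (V \<times> L') \<rightarrow> B\<close> (\<open>ex_glue\<close>). In both cases a problem is a triple \<open>(a, b, c)\<close> with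

    \<^item> \<open>a\<close> and \<open>b\<close> equal on \<open>X \<times> (\<partial>V \<times> \<partial>L)\<close>,
    \<^item> \<open>p \<cdot> a = c \<cdot> (X \<times> (i_V \<times> l))\<close>,
    \<^item> \<open>p \<cdot> b = c \<cdot> (X \<times> (V \<times> (l \<cdot> i_L)))\<close>,

  and a solution is a map \<open>f : X \<times> (V \<times> L) \<rightarrow> E\<close> that restricts to \<open>a\<close> and \<open>b\<close> and satisfies
  \<open>p \<cdot> f = c \<cdot> (X \<times> (V \<times> l))\<close>. The two sides differ in what is built in: on the left the first equation
  is part of being a map into \<open>M_E\<close>, on the right the third one is part of being a map into the domain
  of \<open>q\<close>; the other two are the commutativity of the respective square.

  The hypotheses on \<open>k\<close> enter as follows. Post-composition with \<open>p\<close> acts on the parts because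
  \<open>s_E\<close> and \<open>s_B\<close> are compatible with \<open>[K, p]\<close> (\<open>parts_post_Comp\<close>). The parts of a composite
  \<open>f \<cdot> (X \<times> k)\<close> are the restrictions of \<open>f\<close>, because restriction along \<open>k\<close> is, up to \<open>s_E\<close> and
  \<open>s_B\<close>, the restriction to the pullback (\<open>parts_of_restriction\<close>); for maps into \<open>B\<close> this translates the square of a left problem,
  for maps into \<open>E\<close> the first condition on its solutions.

  All translations are natural in \<open>X\<close>, so that uniform choices of solutions correspond as well
  (\<open>uniform_solutions_bij\<close>).
\<close>

section \<open>Products and pullbacks from finite limits\<close>

context category
begin

text \<open>The equational rules are stated for arrows with matching domains and codomains instead of members of
  given hom-sets: the simplifier can then reassociate a composite without guessing its middle objects.\<close>

lemma hom_iff: "f \<in> hom C X Y \<longleftrightarrow> f \<in> Arr C \<and> Dom C f = X \<and> Cod C f = Y"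
  by (simp add: hom_def)

lemma Ident_arr [simp]:
  assumes "X \<in> Ob C"
  shows "\<one> X \<in> Arr C" "Dom C (\<one> X) = X" "Cod C (\<one> X) = X"
  using Ident_hom[OF assms] by (simp_all add: hom_iff)

lemma Comp_arr [simp]:
  assumes "f \<in> Arr C" "g \<in> Arr C" "Dom C g = Cod C f"
  shows "g \<cdot> f \<in> Arr C" "Dom C (g \<cdot> f) = Dom C f" "Cod C (g \<cdot> f) = Cod C g"
  using Comp_hom[of f "Dom C f" "Cod C f" g "Cod C g"] assms by (simp_all add: hom_iff)

lemma Comp_Ident_simp [simp]: "f \<in> Arr C \<Longrightarrow> Dom C f = X \<Longrightarrow> f \<cdot> \<one> X = f"
  using Comp_Ident[of f "Dom C f" "Cod C f"] by (simp add: hom_iff)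

lemma Ident_Comp_simp [simp]: "f \<in> Arr C \<Longrightarrow> Cod C f = X \<Longrightarrow> \<one> X \<cdot> f = f"
  using Ident_Comp[of f "Dom C f" "Cod C f"] by (simp add: hom_iff)

lemma Comp_assoc_simp [simp]:
  "f \<in> Arr C \<Longrightarrow> g \<in> Arr C \<Longrightarrow> h \<in> Arr C \<Longrightarrow> Dom C g = Cod C f \<Longrightarrow> Dom C h = Cod C g \<Longrightarrow>
    (h \<cdot> g) \<cdot> f = h \<cdot> (g \<cdot> f)"
  using Comp_assoc[of f "Dom C f" "Cod C f" g "Cod C g" h "Cod C h"] by (simp add: hom_iff)

declare Dom_Ob [simp] Cod_Ob [simp]

end

locale lex_category = category C for C :: "('o, 'm) category" (structure) +
  assumes finitely_complete: "finitely_complete C"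
begin

lemma ex_product:
  assumes "X \<in> Ob C" "Y \<in> Ob C"
  shows "\<exists>P a b. is_product C X Y P a b"
proof -
  define J :: "(nat, nat) category" where
    "J = \<lparr>Ob = {0, 1}, Arr = {0, 1}, Dom = id, Cod = id, Ident = id, Comp = (\<lambda>g f. f)\<rparr>"
  define Do where "Do = (\<lambda>j::nat. if j = 0 then X else Y)"
  define Da where "Da = (\<lambda>j. \<one> (Do j))"
  have J_hom: "f \<in> hom J x y \<longleftrightarrow> (f = 0 \<or> f = 1) \<and> x = f \<and> y = f" for f x y
    by (auto simp: hom_def J_def)
  have J_Ob: "Ob J = {0, 1}" by (simp add: J_def)
  have J: "category J"
    by unfold_locales (auto simp: J_hom, auto simp: J_def)
  have Do: "Do 0 = X" "Do 1 = Y" "Do (Suc 0) = Y" by (simp_all add: Do_def)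
  have "is_functor J C Do Da"
    using assms unfolding is_functor_def by (auto simp: J_hom Do Da_def hom_iff, auto simp: J_def Do)
  moreover have "finite (Ob J)" "finite (Arr J)" by (simp_all add: J_def)
  ultimately obtain N \<psi> where lim: "is_limit J C Do Da N \<psi>"
    using J finitely_complete[unfolded finitely_complete_def, rule_format, of J Do Da] by blast
  have cone: "is_cone J C Do Da N' \<psi>' \<longleftrightarrow> \<psi>' 0 \<in> hom C N' X \<and> \<psi>' 1 \<in> hom C N' Y" for N' \<psi>'
  proof -
    have "(\<forall>j j'. \<forall>a \<in> hom J j j'. Da a \<cdot> \<psi>' j = \<psi>' j') \<longleftrightarrow>
        \<one> X \<cdot> \<psi>' 0 = \<psi>' 0 \<and> \<one> Y \<cdot> \<psi>' 1 = \<psi>' 1"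
    proof -
      have "(\<forall>j j'. \<forall>a \<in> hom J j j'. P a j j') \<longleftrightarrow> P 0 0 0 \<and> P 1 1 1" for P
        by (auto simp: J_hom)
      then show ?thesis by (simp add: Da_def Do)
    qed
    moreover have "(\<forall>j \<in> Ob J. \<psi>' j \<in> hom C N' (Do j)) \<longleftrightarrow>
        \<psi>' 0 \<in> hom C N' X \<and> \<psi>' 1 \<in> hom C N' Y"
      by (simp add: J_Ob Do)
    ultimately show ?thesis
      unfolding is_cone_def by (auto simp: hom_iff)
  qed
  have "is_product C X Y N (\<psi> 0) (\<psi> 1)"
    unfolding is_product_def
  proof (intro conjI allI impI)
    show "\<psi> 0 \<in> hom C N X" "\<psi> 1 \<in> hom C N Y"
      using lim by (auto simp: is_limit_def cone)
    fix Z f g assume "f \<in> hom C Z X \<and> g \<in> hom C Z Y"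
    then have "is_cone J C Do Da Z (\<lambda>j. if j = 0 then f else g)"
      by (simp add: cone)
    with lim have "\<exists>!h. h \<in> hom C Z N \<and> (\<forall>j \<in> Ob J. \<psi> j \<cdot> h = (if j = 0 then f else g))"
      unfolding is_limit_def by blast
    then show "\<exists>!h. h \<in> hom C Z N \<and> \<psi> 0 \<cdot> h = f \<and> \<psi> 1 \<cdot> h = g"
      by (simp add: J_def)
  qed
  then show ?thesis by blast
qed

text \<open>In the cospan shape the arrows 0, 1, 2 are the identities, 3 and 4 the two legs. A composite
  always has an identity factor, so that it is the other factor.\<close>

lemma ex_pullback:
  assumes "f \<in> Arr C" "g \<in> Arr C" "Cod C f = Cod C g"
  shows "\<exists>P a b. is_pullback C f g P a b"
proof -
  define J :: "(nat, nat) category" where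
    "J = \<lparr>Ob = {0, 1, 2}, Arr = {0, 1, 2, 3, 4},
          Dom = (\<lambda>a. if a = 3 then 0 else if a = 4 then 1 else a),
          Cod = (\<lambda>a. if a = 3 \<or> a = 4 then 2 else a), Ident = id,
          Comp = (\<lambda>b a. if a \<le> 2 then b else a)\<rparr>"
  define Do where "Do = (\<lambda>j::nat. if j = 0 then Dom C f else if j = 1 then Dom C g else Cod C f)"
  define Da where "Da = (\<lambda>a::nat. if a = 3 then f else if a = 4 then g else \<one> (Do a))"
  have J_hom: "a \<in> hom J x y \<longleftrightarrow> (a = 0 \<and> x = 0 \<and> y = 0) \<or> (a = 1 \<and> x = 1 \<and> y = 1) \<or>
      (a = 2 \<and> x = 2 \<and> y = 2) \<or> (a = 3 \<and> x = 0 \<and> y = 2) \<or> (a = 4 \<and> x = 1 \<and> y = 2)" for a x y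
    by (auto simp: hom_def J_def)
  have J: "category J"
  proof unfold_locales
    fix a b x y z assume "a \<in> hom J x y" "b \<in> hom J y z"
    then show "b \<cdot>\<^bsub>J\<^esub> a \<in> hom J x z"
      by (elim J_hom[THEN iffD1, elim_format] disjE conjE) (simp_all add: J_hom, simp_all add: J_def)
  qed (simp_all add: hom_def, auto simp: J_def)
  have Do: "Do 0 = Dom C f" "Do 1 = Dom C g" "Do (Suc 0) = Dom C g" "Do 2 = Cod C f"
    by (simp_all add: Do_def)
  have Da: "Da 0 = \<one> (Dom C f)" "Da (Suc 0) = \<one> (Dom C g)" "Da 1 = \<one> (Dom C g)"
      "Da 2 = \<one> (Cod C f)" "Da 3 = f" "Da 4 = g"
    by (simp_all add: Da_def Do)
  have "is_functor J C Do Da"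
    using assms unfolding is_functor_def
    by (auto simp: J_hom Do Da hom_iff, auto simp: J_def Do Da hom_iff)
  moreover have "finite (Ob J)" "finite (Arr J)" by (simp_all add: J_def)
  ultimately obtain N \<psi> where lim: "is_limit J C Do Da N \<psi>"
    using J finitely_complete[unfolded finitely_complete_def, rule_format, of J Do Da] by blast
  have cone: "is_cone J C Do Da N' \<psi>' \<longleftrightarrow> \<psi>' 0 \<in> hom C N' (Dom C f) \<and>
      \<psi>' 1 \<in> hom C N' (Dom C g) \<and> f \<cdot> \<psi>' 0 = \<psi>' 2 \<and> g \<cdot> \<psi>' 1 = \<psi>' 2" for N' \<psi>'
  proof -
    have "(\<forall>j j'. \<forall>a \<in> hom J j j'. P a j j') \<longleftrightarrow>
        P 0 0 0 \<and> P 1 1 1 \<and> P 2 2 2 \<and> P 3 0 2 \<and> P 4 1 2" for P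
      by (auto simp: J_hom)
    moreover have "Ob J = {0, 1, 2}" by (simp add: J_def)
    ultimately have cone': "is_cone J C Do Da N' \<psi>' \<longleftrightarrow> N' \<in> Ob C \<and>
        (\<psi>' 0 \<in> hom C N' (Dom C f) \<and> \<psi>' 1 \<in> hom C N' (Dom C g) \<and> \<psi>' 2 \<in> hom C N' (Cod C f)) \<and>
        \<one> (Dom C f) \<cdot> \<psi>' 0 = \<psi>' 0 \<and> \<one> (Dom C g) \<cdot> \<psi>' 1 = \<psi>' 1 \<and>
        \<one> (Cod C f) \<cdot> \<psi>' 2 = \<psi>' 2 \<and> f \<cdot> \<psi>' 0 = \<psi>' 2 \<and> g \<cdot> \<psi>' 1 = \<psi>' 2"
      unfolding is_cone_def by (simp add: Da Do)
    have "\<psi>' 2 \<in> hom C N' (Cod C f)" if "\<psi>' 0 \<in> hom C N' (Dom C f)" "f \<cdot> \<psi>' 0 = \<psi>' 2"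
      using that assms Comp_arr[of "\<psi>' 0" f] by (simp add: hom_iff)
    then show ?thesis
      unfolding cone' by (metis Ident_Comp Dom_Ob hom_iff)
  qed
  have "is_pullback C f g N (\<psi> 0) (\<psi> 1)"
    unfolding is_pullback_def
  proof (intro conjI allI impI)
    show "\<psi> 0 \<in> hom C N (Dom C f)" "\<psi> 1 \<in> hom C N (Dom C g)" "f \<cdot> \<psi> 0 = g \<cdot> \<psi> 1"
      using lim by (auto simp: is_limit_def cone)
    have c2: "\<psi> 0 \<in> hom C N (Dom C f)" "\<psi> 1 \<in> hom C N (Dom C g)" "\<psi> 2 = f \<cdot> \<psi> 0" "g \<cdot> \<psi> 1 = f \<cdot> \<psi> 0"
      using lim by (auto simp: is_limit_def cone)
    fix Z x y
    assume xy: "x \<in> hom C Z (Dom C f) \<and> y \<in> hom C Z (Dom C g) \<and> f \<cdot> x = g \<cdot> y"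
    define \<chi> where "\<chi> = (\<lambda>j::nat. if j = 0 then x else if j = 1 then y else f \<cdot> x)"
    have \<chi>: "\<chi> 0 = x" "\<chi> 1 = y" "\<chi> (Suc 0) = y" "\<chi> 2 = f \<cdot> x" by (simp_all add: \<chi>_def)
    have "is_cone J C Do Da Z \<chi>"
      using xy by (simp add: cone \<chi>)
    with lim have "\<exists>!h. h \<in> hom C Z N \<and> (\<forall>j \<in> Ob J. \<psi> j \<cdot> h = \<chi> j)"
      unfolding is_limit_def by blast
    moreover have "(\<forall>j \<in> Ob J. \<psi> j \<cdot> h = \<chi> j) \<longleftrightarrow> \<psi> 0 \<cdot> h = x \<and> \<psi> 1 \<cdot> h = y"
      if "h \<in> hom C Z N" for h
      using that c2 assms by (auto simp: J_def \<chi> hom_iff)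
    ultimately show "\<exists>!h. h \<in> hom C Z N \<and> \<psi> 0 \<cdot> h = x \<and> \<psi> 1 \<cdot> h = y"
      by (metis (no_types, lifting))
  qed
  then show ?thesis by blast
qed

subsection \<open>Products\<close>

abbreviation prod_ob' (infixr "\<otimes>" 80) where "X \<otimes> Y \<equiv> prod_ob C X Y"
abbreviation prod_map' (infixr "\<otimes>\<^sub>m" 80) where "f \<otimes>\<^sub>m g \<equiv> prod_map C f g"

lemma prod_is_product:
  assumes "X \<in> Ob C" "Y \<in> Ob C"
  shows "is_product C X Y (X \<otimes> Y) (proj1 C X Y) (proj2 C X Y)"
proof -
  have "\<exists>c. case c of (P, a, b) \<Rightarrow> is_product C X Y P a b"
    using ex_product[OF assms] by auto
  then show ?thesis
    unfolding prod_ob_def proj1_def proj2_def prod_cone_def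
    by (metis (mono_tags, lifting) case_prod_beta someI_ex)
qed

lemma proj_arr [simp]:
  assumes "X \<in> Ob C" "Y \<in> Ob C"
  shows "proj1 C X Y \<in> Arr C" "Dom C (proj1 C X Y) = X \<otimes> Y" "Cod C (proj1 C X Y) = X"
    "proj2 C X Y \<in> Arr C" "Dom C (proj2 C X Y) = X \<otimes> Y" "Cod C (proj2 C X Y) = Y"
  using prod_is_product[OF assms] by (auto simp: is_product_def hom_iff)

lemma prod_Ob [simp]: "X \<in> Ob C \<Longrightarrow> Y \<in> Ob C \<Longrightarrow> X \<otimes> Y \<in> Ob C"
  by (metis Dom_Ob proj_arr(1,2))

lemma is_product_factor:
  "is_product C X Y P a b \<Longrightarrow> f \<in> hom C Z X \<Longrightarrow> g \<in> hom C Z Y \<Longrightarrow>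
    \<exists>!h. h \<in> hom C Z P \<and> a \<cdot> h = f \<and> b \<cdot> h = g"
  unfolding is_product_def by blast

lemma prod_arrow_eqI:
  assumes "h \<in> Arr C" "h' \<in> Arr C" "Dom C h = Dom C h'" "Cod C h = X \<otimes> Y" "Cod C h' = X \<otimes> Y"
    and "X \<in> Ob C" "Y \<in> Ob C"
    and "proj1 C X Y \<cdot> h = proj1 C X Y \<cdot> h'" "proj2 C X Y \<cdot> h = proj2 C X Y \<cdot> h'"
  shows "h = h'"
proof -
  have "proj1 C X Y \<cdot> h' \<in> hom C (Dom C h) X" "proj2 C X Y \<cdot> h' \<in> hom C (Dom C h) Y"
    using assms by (simp_all add: hom_iff)
  from is_product_factor[OF prod_is_product this] assms(6,7)
  have "\<exists>!m. m \<in> hom C (Dom C h) (X \<otimes> Y) \<and> proj1 C X Y \<cdot> m = proj1 C X Y \<cdot> h' \<and>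
      proj2 C X Y \<cdot> m = proj2 C X Y \<cdot> h'" by simp
  then show ?thesis
    by (rule ex1E) (use assms in \<open>metis hom_iff\<close>)
qed

lemma pairing_props:
  assumes "f \<in> Arr C" "g \<in> Arr C" "Dom C f = Dom C g"
  shows "pairing C f g \<in> hom C (Dom C f) (Cod C f \<otimes> Cod C g) \<and>
    proj1 C (Cod C f) (Cod C g) \<cdot> pairing C f g = f \<and>
    proj2 C (Cod C f) (Cod C g) \<cdot> pairing C f g = g"
proof -
  have "Cod C f \<in> Ob C" "Cod C g \<in> Ob C" using assms by simp_all
  then have "\<exists>!h. h \<in> hom C (Dom C f) (Cod C f \<otimes> Cod C g) \<and>
    proj1 C (Cod C f) (Cod C g) \<cdot> h = f \<and> proj2 C (Cod C f) (Cod C g) \<cdot> h = g"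
    using is_product_factor[OF prod_is_product, of "Cod C f" "Cod C g" f "Dom C f" g] assms
    by (simp add: hom_iff)
  from theI'[OF this] show ?thesis unfolding pairing_def .
qed

lemma pairing_arr [simp]:
  assumes "f \<in> Arr C" "g \<in> Arr C" "Dom C f = Dom C g"
  shows "pairing C f g \<in> Arr C" "Dom C (pairing C f g) = Dom C g"
    "Cod C (pairing C f g) = Cod C f \<otimes> Cod C g"
  using pairing_props[OF assms] assms by (auto simp: hom_iff)

lemma proj_pairing [simp]:
  assumes "f \<in> Arr C" "g \<in> Arr C" "Dom C f = Dom C g" "Cod C f = X" "Cod C g = Y"
  shows "proj1 C X Y \<cdot> pairing C f g = f" "proj2 C X Y \<cdot> pairing C f g = g"
  using pairing_props[OF assms(1-3)] assms(4,5) by auto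

lemma pairing_unique:
  assumes "h \<in> Arr C" "Cod C h = X \<otimes> Y" "X \<in> Ob C" "Y \<in> Ob C"
    "proj1 C X Y \<cdot> h = f" "proj2 C X Y \<cdot> h = g"
  shows "h = pairing C f g"
proof -
  let ?k = "pairing C f g"
  have fg: "f \<in> hom C (Dom C h) X" "g \<in> hom C (Dom C h) Y"
    using assms by (auto simp: hom_iff)
  then have k: "?k \<in> Arr C" "Dom C ?k = Dom C h" "Cod C ?k = X \<otimes> Y"
    "proj1 C X Y \<cdot> ?k = f" "proj2 C X Y \<cdot> ?k = g"
    by (auto simp: hom_iff)
  show ?thesis
    by (rule prod_arrow_eqI[of h ?k X Y]) (simp_all add: assms k)
qed

text \<open>With this rule every composite of pairings, product maps and projections normalises to nested pairings
  of composites with projections, which decides the coherence equations for \<open>assoc\<close> below.\<close>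

lemma pairing_Comp:
  assumes "f \<in> Arr C" "g \<in> Arr C" "Dom C f = Dom C g" "h \<in> Arr C" "Cod C h = Dom C g"
  shows "pairing C f g \<cdot> h = pairing C (f \<cdot> h) (g \<cdot> h)"
proof (rule pairing_unique[where X = "Cod C f" and Y = "Cod C g"])
  have "proj1 C (Cod C f) (Cod C g) \<cdot> pairing C f g \<cdot> h = f \<cdot> h"
    using assms by (simp del: Comp_assoc_simp)
  then show "proj1 C (Cod C f) (Cod C g) \<cdot> (pairing C f g \<cdot> h) = f \<cdot> h"
    using assms by (simp del: proj_pairing)
  have "proj2 C (Cod C f) (Cod C g) \<cdot> pairing C f g \<cdot> h = g \<cdot> h"
    using assms by (simp del: Comp_assoc_simp)
  then show "proj2 C (Cod C f) (Cod C g) \<cdot> (pairing C f g \<cdot> h) = g \<cdot> h"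
    using assms by (simp del: proj_pairing)
qed (use assms in simp_all)

lemma pairing_proj [simp]:
  "X \<in> Ob C \<Longrightarrow> Y \<in> Ob C \<Longrightarrow> pairing C (proj1 C X Y) (proj2 C X Y) = \<one> (X \<otimes> Y)"
  by (rule pairing_unique[symmetric, where X = X and Y = Y]) simp_all

lemma prod_map_arr [simp]:
  assumes "f \<in> Arr C" "g \<in> Arr C"
  shows "f \<otimes>\<^sub>m g \<in> Arr C" "Dom C (f \<otimes>\<^sub>m g) = Dom C f \<otimes> Dom C g"
    "Cod C (f \<otimes>\<^sub>m g) = Cod C f \<otimes> Cod C g"
  using assms by (simp_all add: prod_map_def)

lemma prod_map_Ident [simp]: "X \<in> Ob C \<Longrightarrow> Y \<in> Ob C \<Longrightarrow> \<one> X \<otimes>\<^sub>m \<one> Y = \<one> (X \<otimes> Y)"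
  by (simp add: prod_map_def)

lemma prod_map_Comp [simp]:
  assumes "f \<in> Arr C" "g \<in> Arr C" "f' \<in> Arr C" "g' \<in> Arr C" "Dom C f = Cod C f'" "Dom C g = Cod C g'"
  shows "(f \<otimes>\<^sub>m g) \<cdot> (f' \<otimes>\<^sub>m g') = (f \<cdot> f') \<otimes>\<^sub>m (g \<cdot> g')"
  using assms by (simp add: prod_map_def pairing_Comp)

definition assoc :: "'o \<Rightarrow> 'o \<Rightarrow> 'o \<Rightarrow> 'm" where
  "assoc X Y Z = pairing C (proj1 C X Y \<cdot> proj1 C (X \<otimes> Y) Z)
     (pairing C (proj2 C X Y \<cdot> proj1 C (X \<otimes> Y) Z) (proj2 C (X \<otimes> Y) Z))"

definition assoc_inv :: "'o \<Rightarrow> 'o \<Rightarrow> 'o \<Rightarrow> 'm" where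
  "assoc_inv X Y Z = pairing C (pairing C (proj1 C X (Y \<otimes> Z)) (proj1 C Y Z \<cdot> proj2 C X (Y \<otimes> Z)))
     (proj2 C Y Z \<cdot> proj2 C X (Y \<otimes> Z))"

lemma assoc_arr [simp]:
  assumes "X \<in> Ob C" "Y \<in> Ob C" "Z \<in> Ob C"
  shows "assoc X Y Z \<in> Arr C" "Dom C (assoc X Y Z) = (X \<otimes> Y) \<otimes> Z"
    "Cod C (assoc X Y Z) = X \<otimes> Y \<otimes> Z"
    "assoc_inv X Y Z \<in> Arr C" "Cod C (assoc_inv X Y Z) = (X \<otimes> Y) \<otimes> Z"
    "Dom C (assoc_inv X Y Z) = X \<otimes> Y \<otimes> Z"
  using assms by (simp_all add: assoc_def assoc_inv_def)

lemma pairing_proj_Comp: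
  "X \<in> Ob C \<Longrightarrow> Y \<in> Ob C \<Longrightarrow> h \<in> Arr C \<Longrightarrow> Cod C h = X \<otimes> Y \<Longrightarrow>
    pairing C (proj1 C X Y \<cdot> h) (proj2 C X Y \<cdot> h) = h"
  by (rule pairing_unique[symmetric, where X = X and Y = Y]) simp_all

lemma assoc_iso [simp]:
  assumes "X \<in> Ob C" "Y \<in> Ob C" "Z \<in> Ob C"
  shows "assoc X Y Z \<cdot> assoc_inv X Y Z = \<one> (X \<otimes> Y \<otimes> Z)"
    "assoc_inv X Y Z \<cdot> assoc X Y Z = \<one> ((X \<otimes> Y) \<otimes> Z)"
  using assms by (simp_all add: assoc_def assoc_inv_def pairing_Comp pairing_proj_Comp)

lemma assoc_natural:
  assumes "f \<in> Arr C" "g \<in> Arr C" "h \<in> Arr C"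
  shows "assoc (Cod C f) (Cod C g) (Cod C h) \<cdot> ((f \<otimes>\<^sub>m g) \<otimes>\<^sub>m h) =
    (f \<otimes>\<^sub>m g \<otimes>\<^sub>m h) \<cdot> assoc (Dom C f) (Dom C g) (Dom C h)"
  using assms by (simp add: assoc_def prod_map_def pairing_Comp)

subsection \<open>Pullbacks\<close>

lemma pb_is_pullback:
  assumes "f \<in> Arr C" "g \<in> Arr C" "Cod C f = Cod C g"
  shows "is_pullback C f g (pb_ob C f g) (pb_proj1 C f g) (pb_proj2 C f g)"
proof -
  have "\<exists>c. case c of (P, a, b) \<Rightarrow> is_pullback C f g P a b"
    using ex_pullback[OF assms] by auto
  then show ?thesis
    unfolding pb_ob_def pb_proj1_def pb_proj2_def pb_cone_def
    by (metis (mono_tags, lifting) case_prod_beta someI_ex)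
qed

lemma pb_proj_arr [simp]:
  assumes "f \<in> Arr C" "g \<in> Arr C" "Cod C f = Cod C g"
  shows "pb_proj1 C f g \<in> Arr C" "Dom C (pb_proj1 C f g) = pb_ob C f g"
    "Cod C (pb_proj1 C f g) = Dom C f"
    "pb_proj2 C f g \<in> Arr C" "Dom C (pb_proj2 C f g) = pb_ob C f g"
    "Cod C (pb_proj2 C f g) = Dom C g"
  using pb_is_pullback[OF assms] by (simp_all add: is_pullback_def hom_iff)

lemma pb_ob_Ob [simp]:
  assumes "f \<in> Arr C" "g \<in> Arr C" "Cod C f = Cod C g"
  shows "pb_ob C f g \<in> Ob C"
  using pb_proj_arr[OF assms] by (metis Dom_Ob)

lemma pb_commute:
  assumes "f \<in> Arr C" "g \<in> Arr C" "Cod C f = Cod C g"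
  shows "f \<cdot> pb_proj1 C f g = g \<cdot> pb_proj2 C f g"
  using pb_is_pullback[OF assms] by (simp add: is_pullback_def)

lemma pb_commute_Comp:
  assumes "f \<in> Arr C" "g \<in> Arr C" "Cod C f = Cod C g" "h \<in> Arr C" "Cod C h = pb_ob C f g"
  shows "f \<cdot> (pb_proj1 C f g \<cdot> h) = g \<cdot> (pb_proj2 C f g \<cdot> h)"
proof -
  have "(f \<cdot> pb_proj1 C f g) \<cdot> h = (g \<cdot> pb_proj2 C f g) \<cdot> h"
    using pb_commute[OF assms(1-3)] by simp
  then show ?thesis using assms by simp
qed

lemma is_pullback_factor:
  "is_pullback C f g P a b \<Longrightarrow> x \<in> hom C Z (Dom C f) \<Longrightarrow> y \<in> hom C Z (Dom C g) \<Longrightarrow>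
    f \<cdot> x = g \<cdot> y \<Longrightarrow> \<exists>!h. h \<in> hom C Z P \<and> a \<cdot> h = x \<and> b \<cdot> h = y"
  unfolding is_pullback_def by blast

lemma pb_arrow_eqI:
  assumes fg: "f \<in> Arr C" "g \<in> Arr C" "Cod C f = Cod C g"
    and h: "h \<in> Arr C" "h' \<in> Arr C" "Dom C h = Dom C h'" "Cod C h = pb_ob C f g" "Cod C h' = pb_ob C f g"
    and eq: "pb_proj1 C f g \<cdot> h = pb_proj1 C f g \<cdot> h'" "pb_proj2 C f g \<cdot> h = pb_proj2 C f g \<cdot> h'"
  shows "h = h'"
proof -
  have "pb_proj1 C f g \<cdot> h' \<in> hom C (Dom C h) (Dom C f)" "pb_proj2 C f g \<cdot> h' \<in> hom C (Dom C h) (Dom C g)"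
    using assms by (simp_all add: hom_iff)
  from is_pullback_factor[OF pb_is_pullback[OF fg] this pb_commute_Comp[OF fg h(2) h(5)]]
  show ?thesis
    by (rule ex1E) (use assms in \<open>metis hom_iff\<close>)
qed

lemma pb_arrow_eq_iff:
  assumes "f \<in> Arr C" "g \<in> Arr C" "Cod C f = Cod C g"
    and "h \<in> Arr C" "h' \<in> Arr C" "Dom C h = Dom C h'" "Cod C h = pb_ob C f g" "Cod C h' = pb_ob C f g"
  shows "h = h' \<longleftrightarrow> pb_proj1 C f g \<cdot> h = pb_proj1 C f g \<cdot> h' \<and> pb_proj2 C f g \<cdot> h = pb_proj2 C f g \<cdot> h'"
  using pb_arrow_eqI[OF assms] by blast

lemma pb_pairing_props:
  assumes "f \<in> Arr C" "g \<in> Arr C" "Cod C f = Cod C g"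
    and "x \<in> Arr C" "y \<in> Arr C" "Dom C x = Dom C y" "Cod C x = Dom C f" "Cod C y = Dom C g"
    and "f \<cdot> x = g \<cdot> y"
  shows "pb_pairing C f g x y \<in> hom C (Dom C x) (pb_ob C f g) \<and>
    pb_proj1 C f g \<cdot> pb_pairing C f g x y = x \<and> pb_proj2 C f g \<cdot> pb_pairing C f g x y = y"
proof -
  have "\<exists>!h. h \<in> hom C (Dom C x) (pb_ob C f g) \<and> pb_proj1 C f g \<cdot> h = x \<and> pb_proj2 C f g \<cdot> h = y"
    by (rule is_pullback_factor[OF pb_is_pullback]) (use assms in \<open>simp_all add: hom_iff\<close>)
  from theI'[OF this] show ?thesis unfolding pb_pairing_def .
qed

lemma pb_pairing_arr:
  assumes "f \<in> Arr C" "g \<in> Arr C" "Cod C f = Cod C g"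
    and "x \<in> Arr C" "y \<in> Arr C" "Dom C x = Dom C y" "Cod C x = Dom C f" "Cod C y = Dom C g"
    and "f \<cdot> x = g \<cdot> y"
  shows "pb_pairing C f g x y \<in> Arr C" "Dom C (pb_pairing C f g x y) = Dom C y"
    "Cod C (pb_pairing C f g x y) = pb_ob C f g"
    "pb_proj1 C f g \<cdot> pb_pairing C f g x y = x" "pb_proj2 C f g \<cdot> pb_pairing C f g x y = y"
  using pb_pairing_props[OF assms] assms(6) by (simp_all add: hom_iff)

section \<open>Exponentials\<close>

abbreviation exp_ob' ("\<lbrakk>_, _\<rbrakk>") where "\<lbrakk>A, Y\<rbrakk> \<equiv> exp_ob C A Y"

lemma exponentiable_Ob [simp]: "exponentiable C A \<Longrightarrow> A \<in> Ob C"
  by (simp add: exponentiable_def)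

lemma exp_is_exponential:
  assumes "exponentiable C A"
  shows "is_exponential C A (exp_ob C A) (exp_map C A) (exp_transpose C A)"
proof -
  have "\<exists>G. case G of (Go, Ga, \<phi>) \<Rightarrow> is_exponential C A Go Ga \<phi>"
    using assms unfolding exponentiable_def by auto
  then show ?thesis
    unfolding exp_ob_def exp_map_def exp_transpose_def exp_adj_def
    by (metis (mono_tags, lifting) case_prod_beta someI_ex)
qed

lemma exp_functor:
  assumes "exponentiable C A"
  shows "is_functor C C (exp_ob C A) (exp_map C A)"
  using exp_is_exponential[OF assms] unfolding is_exponential_def adjunction_def by simp

lemma exp_ob_Ob [simp]: "exponentiable C A \<Longrightarrow> Y \<in> Ob C \<Longrightarrow> \<lbrakk>A, Y\<rbrakk> \<in> Ob C"
  using exp_functor unfolding is_functor_def by blast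

lemma exp_map_hom: "exponentiable C A \<Longrightarrow> h \<in> hom C Y Z \<Longrightarrow> exp_map C A h \<in> hom C \<lbrakk>A, Y\<rbrakk> \<lbrakk>A, Z\<rbrakk>"
  using exp_functor unfolding is_functor_def by blast

lemma exp_map_arr [simp]:
  assumes "exponentiable C A" "h \<in> Arr C"
  shows "exp_map C A h \<in> Arr C" "Dom C (exp_map C A h) = \<lbrakk>A, Dom C h\<rbrakk>"
    "Cod C (exp_map C A h) = \<lbrakk>A, Cod C h\<rbrakk>"
  using exp_map_hom[OF assms(1), of h "Dom C h" "Cod C h"] assms(2) by (simp_all add: hom_iff)

lemma exp_map_Ident [simp]:
  "exponentiable C A \<Longrightarrow> Y \<in> Ob C \<Longrightarrow> exp_map C A (\<one> Y) = \<one> \<lbrakk>A, Y\<rbrakk>"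
  using exp_functor unfolding is_functor_def by blast

lemma exp_map_Comp:
  "exponentiable C A \<Longrightarrow> f \<in> hom C X Y \<Longrightarrow> g \<in> hom C Y Z \<Longrightarrow>
    exp_map C A (g \<cdot> f) = exp_map C A g \<cdot> exp_map C A f"
  using exp_functor unfolding is_functor_def by blast

lemma transpose_bij:
  "exponentiable C A \<Longrightarrow> X \<in> Ob C \<Longrightarrow> Y \<in> Ob C \<Longrightarrow>
    bij_betw (exp_transpose C A X Y) (hom C (X \<otimes> A) Y) (hom C X \<lbrakk>A, Y\<rbrakk>)"
  using exp_is_exponential unfolding is_exponential_def adjunction_def by blast

lemma transpose_natural:
  assumes "exponentiable C A" "t \<in> hom C X' X" "h \<in> hom C Y Y'" "g \<in> hom C (X \<otimes> A) Y"
  shows "exp_transpose C A X' Y' (h \<cdot> g \<cdot> (t \<otimes>\<^sub>m \<one> A)) = exp_map C A h \<cdot> exp_transpose C A X Y g \<cdot> t"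
  using exp_is_exponential[OF assms(1)] assms(2-4) unfolding is_exponential_def adjunction_def by blast

lemma transpose_arr [simp]:
  assumes "exponentiable C A" "g \<in> Arr C" "X \<in> Ob C" "Dom C g = X \<otimes> A" "Cod C g = Y"
  shows "exp_transpose C A X Y g \<in> Arr C" "Dom C (exp_transpose C A X Y g) = X"
    "Cod C (exp_transpose C A X Y g) = \<lbrakk>A, Y\<rbrakk>"
proof -
  have "Y \<in> Ob C" "g \<in> hom C (X \<otimes> A) Y" using assms by (auto simp: hom_iff)
  then have "exp_transpose C A X Y g \<in> hom C X \<lbrakk>A, Y\<rbrakk>"
    using transpose_bij[OF assms(1,3)] by (auto simp: bij_betw_def)
  then show "exp_transpose C A X Y g \<in> Arr C" "Dom C (exp_transpose C A X Y g) = X"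
    "Cod C (exp_transpose C A X Y g) = \<lbrakk>A, Y\<rbrakk>"
    by (simp_all add: hom_iff)
qed

lemma transpose_eq_iff:
  assumes "exponentiable C A" "X \<in> Ob C" "Y \<in> Ob C" "g \<in> hom C (X \<otimes> A) Y" "g' \<in> hom C (X \<otimes> A) Y"
  shows "exp_transpose C A X Y g = exp_transpose C A X Y g' \<longleftrightarrow> g = g'"
  using transpose_bij[OF assms(1-3)] assms(4,5) by (auto simp: bij_betw_def inj_on_def)

lemma transpose_post_Comp:
  assumes "exponentiable C A" "X \<in> Ob C" "h \<in> Arr C" "g \<in> Arr C" "Dom C g = X \<otimes> A"
    "Dom C h = Cod C g" "Cod C h = Y'" "Cod C g = Y"
  shows "exp_transpose C A X Y' (h \<cdot> g) = exp_map C A h \<cdot> exp_transpose C A X Y g"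
  using transpose_natural[of A "\<one> X" X X h Y Y' g] assms by (simp add: hom_iff)

lemma transpose_pre_Comp:
  assumes "exponentiable C A" "t \<in> Arr C" "g \<in> Arr C" "Dom C g = X \<otimes> A" "Dom C t = X'"
    "Cod C t = X" "Cod C g = Y"
  shows "exp_transpose C A X' Y (g \<cdot> (t \<otimes>\<^sub>m \<one> A)) = exp_transpose C A X Y g \<cdot> t"
proof -
  have "Y \<in> Ob C" "X \<in> Ob C" "X' \<in> Ob C" using assms by auto
  then show ?thesis
    using transpose_natural[of A t X' X "\<one> Y" Y Y g] assms by (simp add: hom_iff)
qed

text \<open>The counterpart of \<open>exp_transpose\<close>. The evaluation map is its value at an identity.\<close>

definition untranspose :: "'o \<Rightarrow> 'o \<Rightarrow> 'o \<Rightarrow> 'm \<Rightarrow> 'm" where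
  "untranspose A X Y = inv_into (hom C (X \<otimes> A) Y) (exp_transpose C A X Y)"

lemma untranspose_arr [simp]:
  assumes "exponentiable C A" "g \<in> Arr C" "Y \<in> Ob C" "Dom C g = X" "Cod C g = \<lbrakk>A, Y\<rbrakk>"
  shows "untranspose A X Y g \<in> Arr C" "Dom C (untranspose A X Y g) = X \<otimes> A"
    "Cod C (untranspose A X Y g) = Y" "exp_transpose C A X Y (untranspose A X Y g) = g"
proof -
  have "X \<in> Ob C" "g \<in> hom C X \<lbrakk>A, Y\<rbrakk>" using assms by (auto simp: hom_iff)
  then have g: "g \<in> exp_transpose C A X Y ` hom C (X \<otimes> A) Y"
    using transpose_bij[OF assms(1) _ assms(3)] by (simp add: bij_betw_def)
  from inv_into_into[OF g] have "untranspose A X Y g \<in> hom C (X \<otimes> A) Y"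
    by (simp add: untranspose_def)
  then show "untranspose A X Y g \<in> Arr C" "Dom C (untranspose A X Y g) = X \<otimes> A"
    "Cod C (untranspose A X Y g) = Y"
    by (simp_all add: hom_iff)
  from f_inv_into_f[OF g] show "exp_transpose C A X Y (untranspose A X Y g) = g"
    by (simp add: untranspose_def)
qed

lemma untranspose_transpose:
  assumes "exponentiable C A" "g \<in> Arr C" "X \<in> Ob C" "Dom C g = X \<otimes> A" "Cod C g = Y"
  shows "untranspose A X Y (exp_transpose C A X Y g) = g"
proof -
  have "Y \<in> Ob C" using assms by auto
  then show ?thesis
    unfolding untranspose_def
    using inv_into_f_f[OF bij_betw_imp_inj_on[OF transpose_bij[OF assms(1,3)]], of Y g] assms
    by (simp add: hom_iff)
qed

lemma eval_map_arr [simp]: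
  assumes "exponentiable C A" "Y \<in> Ob C"
  shows "eval_map C A Y \<in> Arr C" "Dom C (eval_map C A Y) = \<lbrakk>A, Y\<rbrakk> \<otimes> A"
    "Cod C (eval_map C A Y) = Y" "exp_transpose C A \<lbrakk>A, Y\<rbrakk> Y (eval_map C A Y) = \<one> \<lbrakk>A, Y\<rbrakk>"
  using untranspose_arr[OF assms(1) _ assms(2), of "\<one> \<lbrakk>A, Y\<rbrakk>" "\<lbrakk>A, Y\<rbrakk>"] assms
  by (simp_all add: eval_map_def untranspose_def)

lemma eval_transpose:
  assumes "exponentiable C A" "g \<in> Arr C" "X \<in> Ob C" "Dom C g = X \<otimes> A" "Cod C g = Y"
  shows "eval_map C A Y \<cdot> (exp_transpose C A X Y g \<otimes>\<^sub>m \<one> A) = g"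
proof -
  have Y: "Y \<in> Ob C" using assms by auto
  have "exp_transpose C A X Y (eval_map C A Y \<cdot> (exp_transpose C A X Y g \<otimes>\<^sub>m \<one> A)) = exp_transpose C A X Y g"
    using assms Y by (subst transpose_pre_Comp[where X = "\<lbrakk>A, Y\<rbrakk>"]) simp_all
  then show ?thesis
    by (subst (asm) transpose_eq_iff) (use assms Y in \<open>simp_all add: hom_iff\<close>)
qed

lemma exp_restrict_arr [simp]:
  assumes "a \<in> Arr C" "exponentiable C (Dom C a)" "exponentiable C (Cod C a)" "Y \<in> Ob C"
  shows "exp_restrict C a Y \<in> Arr C" "Dom C (exp_restrict C a Y) = \<lbrakk>Cod C a, Y\<rbrakk>"
    "Cod C (exp_restrict C a Y) = \<lbrakk>Dom C a, Y\<rbrakk>"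
  using assms by (simp_all add: exp_restrict_def)

text \<open>By naturality, restriction need only be computed on the evaluation map, where it is
  the definition of \<open>exp_restrict\<close>.\<close>

lemma transpose_restrict:
  assumes "exponentiable C A" "exponentiable C A'" "a \<in> Arr C" "Dom C a = A" "Cod C a = A'"
    and "g \<in> Arr C" "X \<in> Ob C" "Dom C g = X \<otimes> A'" "Cod C g = Y"
  shows "exp_transpose C A X Y (g \<cdot> (\<one> X \<otimes>\<^sub>m a)) = exp_restrict C a Y \<cdot> exp_transpose C A' X Y g"
proof -
  let ?ev = "eval_map C A' Y" and ?g = "exp_transpose C A' X Y g"
  have Y: "Y \<in> Ob C" using assms by auto
  have "g \<cdot> (\<one> X \<otimes>\<^sub>m a) = ?ev \<cdot> (?g \<otimes>\<^sub>m \<one> A') \<cdot> (\<one> X \<otimes>\<^sub>m a)"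
    using assms by (simp add: eval_transpose del: Comp_assoc_simp)
  also have "\<dots> = ?ev \<cdot> (\<one> \<lbrakk>A', Y\<rbrakk> \<otimes>\<^sub>m a) \<cdot> (?g \<otimes>\<^sub>m \<one> A)"
    using assms Y by simp
  finally have "exp_transpose C A X Y (g \<cdot> (\<one> X \<otimes>\<^sub>m a)) =
      exp_transpose C A X Y (?ev \<cdot> (\<one> \<lbrakk>A', Y\<rbrakk> \<otimes>\<^sub>m a) \<cdot> (?g \<otimes>\<^sub>m \<one> A))"
    by simp
  also have "\<dots> = exp_transpose C A \<lbrakk>A', Y\<rbrakk> Y (?ev \<cdot> (\<one> \<lbrakk>A', Y\<rbrakk> \<otimes>\<^sub>m a)) \<cdot> ?g"
    by (rule transpose_pre_Comp) (use assms Y in simp_all)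
  finally show ?thesis
    using assms by (simp add: exp_restrict_def)
qed

text \<open>Both sides are the transpose of \<open>p \<cdot> ev \<cdot> (1 \<times> a)\<close>, where \<open>ev\<close> is evaluation.\<close>

lemma exp_restrict_natural:
  assumes "exponentiable C A" "exponentiable C A'" "a \<in> Arr C" "Dom C a = A" "Cod C a = A'"
    and "p \<in> Arr C" "Dom C p = E" "Cod C p = B"
  shows "exp_restrict C a B \<cdot> exp_map C A' p = exp_map C A p \<cdot> exp_restrict C a E"
proof -
  let ?ev = "eval_map C A' E"
  have Ob: "E \<in> Ob C" "B \<in> Ob C" using assms by auto
  have "exp_restrict C a B \<cdot> exp_map C A' p =
      exp_restrict C a B \<cdot> exp_transpose C A' \<lbrakk>A', E\<rbrakk> B (p \<cdot> ?ev)"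
    using assms Ob by (simp add: transpose_post_Comp[where Y = E])
  also have "\<dots> = exp_transpose C A \<lbrakk>A', E\<rbrakk> B (p \<cdot> ?ev \<cdot> (\<one> \<lbrakk>A', E\<rbrakk> \<otimes>\<^sub>m a))"
    using assms Ob by (intro transpose_restrict[symmetric]) simp_all
  also have "\<dots> = exp_map C A p \<cdot> exp_restrict C a E"
    using assms Ob by (simp add: transpose_post_Comp[where Y = E] exp_restrict_def)
  finally show ?thesis .
qed

lemma exp_restrict_Comp:
  assumes "exponentiable C A" "exponentiable C A'" "exponentiable C A''" "Y \<in> Ob C"
    and "a \<in> Arr C" "Dom C a = A" "Cod C a = A'" "b \<in> Arr C" "Dom C b = A'" "Cod C b = A''"
  shows "exp_restrict C a Y \<cdot> exp_restrict C b Y = exp_restrict C (b \<cdot> a) Y"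
proof -
  let ?ev = "eval_map C A'' Y"
  have "exp_restrict C a Y \<cdot> exp_restrict C b Y =
      exp_transpose C A \<lbrakk>A'', Y\<rbrakk> Y ((?ev \<cdot> (\<one> \<lbrakk>A'', Y\<rbrakk> \<otimes>\<^sub>m b)) \<cdot> (\<one> \<lbrakk>A'', Y\<rbrakk> \<otimes>\<^sub>m a))"
    unfolding exp_restrict_def[of C b] using assms
    by (subst transpose_restrict[where A = A and A' = A']) simp_all
  then show ?thesis
    using assms by (simp add: exp_restrict_def[of C "b \<cdot> a"])
qed

section \<open>Currying the last factor of a triple product\<close>

text \<open>A map on \<open>X \<times> (W \<times> A)\<close>, the bracketing that occurs in left problems, becomes a map from \<open>X \<times> W\<close> to
  \<open>[A, Y]\<close>, the form that occurs in right problems.\<close>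

definition curry_last :: "'o \<Rightarrow> 'o \<Rightarrow> 'o \<Rightarrow> 'o \<Rightarrow> 'm \<Rightarrow> 'm" where
  "curry_last X W A Y g = exp_transpose C A (X \<otimes> W) Y (g \<cdot> assoc X W A)"

lemma curry_last_arr [simp]:
  assumes "exponentiable C A" "X \<in> Ob C" "W \<in> Ob C" "g \<in> Arr C" "Dom C g = X \<otimes> W \<otimes> A" "Cod C g = Y"
  shows "curry_last X W A Y g \<in> Arr C" "Dom C (curry_last X W A Y g) = X \<otimes> W"
    "Cod C (curry_last X W A Y g) = \<lbrakk>A, Y\<rbrakk>"
  using assms by (simp_all add: curry_last_def)

lemma curry_last_eq_iff:
  assumes "exponentiable C A" "X \<in> Ob C" "W \<in> Ob C"
    and "g \<in> hom C (X \<otimes> W \<otimes> A) Y" "g' \<in> hom C (X \<otimes> W \<otimes> A) Y"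
  shows "curry_last X W A Y g = curry_last X W A Y g' \<longleftrightarrow> g = g'"
proof
  assume "curry_last X W A Y g = curry_last X W A Y g'"
  then have "g \<cdot> assoc X W A = g' \<cdot> assoc X W A"
    unfolding curry_last_def
    by (subst (asm) transpose_eq_iff) (use assms in \<open>auto simp: hom_iff\<close>)
  then have "(g \<cdot> assoc X W A) \<cdot> assoc_inv X W A = (g' \<cdot> assoc X W A) \<cdot> assoc_inv X W A" by simp
  then show "g = g'" using assms by (simp add: hom_iff)
qed simp

lemma curry_last_surj:
  assumes "exponentiable C A" "X \<in> Ob C" "W \<in> Ob C" "Y \<in> Ob C"
    and "h \<in> hom C (X \<otimes> W) \<lbrakk>A, Y\<rbrakk>"
  obtains g where "g \<in> hom C (X \<otimes> W \<otimes> A) Y" "curry_last X W A Y g = h"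
proof
  let ?g = "untranspose A (X \<otimes> W) Y h"
  show "?g \<cdot> assoc_inv X W A \<in> hom C (X \<otimes> W \<otimes> A) Y"
    "curry_last X W A Y (?g \<cdot> assoc_inv X W A) = h"
    using assms by (simp_all add: hom_iff curry_last_def)
qed

lemma curry_last_bij:
  assumes "exponentiable C A" "X \<in> Ob C" "W \<in> Ob C" "Y \<in> Ob C"
  shows "bij_betw (curry_last X W A Y) (hom C (X \<otimes> W \<otimes> A) Y) (hom C (X \<otimes> W) \<lbrakk>A, Y\<rbrakk>)"
  unfolding bij_betw_def
proof (intro conjI set_eqI iffI)
  show "inj_on (curry_last X W A Y) (hom C (X \<otimes> W \<otimes> A) Y)"
    using curry_last_eq_iff[OF assms(1-3)] by (auto simp: inj_on_def)
next
  fix h assume "h \<in> curry_last X W A Y ` hom C (X \<otimes> W \<otimes> A) Y"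
  then show "h \<in> hom C (X \<otimes> W) \<lbrakk>A, Y\<rbrakk>" using assms by (auto simp: hom_iff)
next
  fix h assume "h \<in> hom C (X \<otimes> W) \<lbrakk>A, Y\<rbrakk>"
  then show "h \<in> curry_last X W A Y ` hom C (X \<otimes> W \<otimes> A) Y"
    using curry_last_surj[OF assms] by blast
qed

lemma curry_last_post_Comp:
  assumes "exponentiable C A" "X \<in> Ob C" "W \<in> Ob C" "g \<in> Arr C" "h \<in> Arr C"
    and "Dom C g = X \<otimes> W \<otimes> A" "Dom C h = Cod C g" "Cod C h = Y'" "Cod C g = Y"
  shows "curry_last X W A Y' (h \<cdot> g) = exp_map C A h \<cdot> curry_last X W A Y g"
  using assms transpose_post_Comp[of A "X \<otimes> W" h "g \<cdot> assoc X W A" Y' Y]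
  by (simp add: curry_last_def)

lemma curry_last_pre_Comp:
  assumes "exponentiable C A" "t \<in> Arr C" "w \<in> Arr C" "g \<in> Arr C"
    and "Dom C t = X'" "Cod C t = X" "Dom C w = W'" "Cod C w = W"
    and "Dom C g = X \<otimes> W \<otimes> A" "Cod C g = Y"
  shows "curry_last X' W' A Y (g \<cdot> (t \<otimes>\<^sub>m w \<otimes>\<^sub>m \<one> A)) = curry_last X W A Y g \<cdot> (t \<otimes>\<^sub>m w)"
proof -
  have Ob: "X \<in> Ob C" "X' \<in> Ob C" "W \<in> Ob C" "W' \<in> Ob C" using assms by auto
  have "(g \<cdot> (t \<otimes>\<^sub>m w \<otimes>\<^sub>m \<one> A)) \<cdot> assoc X' W' A = (g \<cdot> assoc X W A) \<cdot> ((t \<otimes>\<^sub>m w) \<otimes>\<^sub>m \<one> A)"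
    using assms Ob assoc_natural[of t w "\<one> A"] by simp
  moreover have "exp_transpose C A (X' \<otimes> W') Y ((g \<cdot> assoc X W A) \<cdot> ((t \<otimes>\<^sub>m w) \<otimes>\<^sub>m \<one> A)) =
      curry_last X W A Y g \<cdot> (t \<otimes>\<^sub>m w)"
    unfolding curry_last_def by (rule transpose_pre_Comp) (use assms Ob in simp_all)
  ultimately show ?thesis by (simp only: curry_last_def)
qed

lemma curry_last_restrict:
  assumes "exponentiable C A" "exponentiable C A'" "a \<in> Arr C" "Dom C a = A" "Cod C a = A'"
    and "g \<in> Arr C" "X \<in> Ob C" "W \<in> Ob C" "Dom C g = X \<otimes> W \<otimes> A'" "Cod C g = Y"
  shows "curry_last X W A Y (g \<cdot> (\<one> X \<otimes>\<^sub>m \<one> W \<otimes>\<^sub>m a)) = exp_restrict C a Y \<cdot> curry_last X W A' Y g"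
proof -
  have "(g \<cdot> (\<one> X \<otimes>\<^sub>m \<one> W \<otimes>\<^sub>m a)) \<cdot> assoc X W A = (g \<cdot> assoc X W A') \<cdot> (\<one> (X \<otimes> W) \<otimes>\<^sub>m a)"
    using assms assoc_natural[of "\<one> X" "\<one> W" a] by simp
  moreover have "exp_transpose C A (X \<otimes> W) Y ((g \<cdot> assoc X W A') \<cdot> (\<one> (X \<otimes> W) \<otimes>\<^sub>m a)) =
      exp_restrict C a Y \<cdot> curry_last X W A' Y g"
    unfolding curry_last_def by (rule transpose_restrict) (use assms in simp_all)
  ultimately show ?thesis by (simp only: curry_last_def)
qed

text \<open>The power \<open>[A \<times> B, -]\<close> exists because it can be computed as \<open>[A, [B, -]]\<close>.\<close>

lemma exponentiable_prod [simp]: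
  assumes A: "exponentiable C A" and B: "exponentiable C B"
  shows "exponentiable C (A \<otimes> B)"
proof -
  let ?Fo = "\<lambda>X. X \<otimes> A \<otimes> B" and ?Fa = "\<lambda>f. f \<otimes>\<^sub>m \<one> (A \<otimes> B)"
  let ?Go = "\<lambda>Y. \<lbrakk>A, \<lbrakk>B, Y\<rbrakk>\<rbrakk>" and ?Ga = "\<lambda>h. exp_map C A (exp_map C B h)"
  let ?\<phi> = "\<lambda>X Y g. exp_transpose C A X \<lbrakk>B, Y\<rbrakk> (curry_last X A B Y g)"
  have Fun: "is_functor C C ?Fo ?Fa"
    using A B unfolding is_functor_def by (auto simp: hom_iff)
  have Gun: "is_functor C C ?Go ?Ga"
    unfolding is_functor_def
  proof (intro conjI allI ballI)
    fix X Y Z f g assume "f \<in> hom C X Y" "g \<in> hom C Y Z"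
    then show "?Ga (g \<cdot> f) = ?Ga g \<cdot> ?Ga f"
      using A B by (metis exp_map_Comp exp_map_hom)
  qed (use A B in \<open>auto intro: exp_map_hom\<close>)
  have bij: "bij_betw (?\<phi> X Y) (hom C (?Fo X) Y) (hom C X (?Go Y))" if "X \<in> Ob C" "Y \<in> Ob C" for X Y
    using bij_betw_trans[OF curry_last_bij[OF B that(1) _ that(2)] transpose_bij[OF A that(1)]] A B that
    by (simp add: comp_def)
  have nat: "?\<phi> X' Y' (g \<cdot> f \<cdot> ?Fa h) = ?Ga g \<cdot> ?\<phi> X Y f \<cdot> h"
    if "h \<in> hom C X' X" "g \<in> hom C Y Y'" "f \<in> hom C (?Fo X) Y" for X X' Y Y' h g f
  proof -
    have Ob: "X \<in> Ob C" "X' \<in> Ob C" "Y \<in> Ob C" "Y' \<in> Ob C" using that by (auto simp: hom_iff)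
    have "curry_last X' A B Y' (g \<cdot> f \<cdot> ?Fa h) = exp_map C B g \<cdot> curry_last X A B Y f \<cdot> (h \<otimes>\<^sub>m \<one> A)"
      using that A B Ob curry_last_pre_Comp[of B h "\<one> A" f X' X A A Y]
        curry_last_post_Comp[of B X' A "f \<cdot> ?Fa h" g Y' Y]
      by (simp add: hom_iff)
    then show ?thesis
      using transpose_natural[OF A that(1), of "exp_map C B g" "\<lbrakk>B, Y\<rbrakk>" "\<lbrakk>B, Y'\<rbrakk>" "curry_last X A B Y f"]
        that A B Ob by (simp add: hom_iff)
  qed
  have "is_exponential C (A \<otimes> B) ?Go ?Ga ?\<phi>"
    unfolding is_exponential_def adjunction_def using Fun Gun bij nat by blast
  then show ?thesis
    using A B unfolding exponentiable_def by auto
qed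

end

section \<open>Uniform choices of solutions\<close>

text \<open>What left- and right-restricted lifting structures have in common: problems \<open>P\<close>, given by two pieces of
  data, their solutions \<open>S\<close>, and the restriction of data and solutions along the maps \<open>H\<close> between
  stages. The default value outside \<open>P\<close> makes a structure determined by its solutions.\<close>

definition uniform_solutions ::
  "('o \<Rightarrow> 'a \<Rightarrow> 'b \<Rightarrow> bool) \<Rightarrow> ('o \<Rightarrow> 'a \<Rightarrow> 'b \<Rightarrow> 'c \<Rightarrow> bool) \<Rightarrow> ('o \<Rightarrow> 'o \<Rightarrow> 't set) \<Rightarrow>
   ('t \<Rightarrow> 'a \<Rightarrow> 'a) \<Rightarrow> ('t \<Rightarrow> 'b \<Rightarrow> 'b) \<Rightarrow> ('t \<Rightarrow> 'c \<Rightarrow> 'c) \<Rightarrow> ('o \<Rightarrow> 'a \<Rightarrow> 'b \<Rightarrow> 'c) set" where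
  "uniform_solutions P S H ru rv rf = {F.
     (\<forall>X u v. P X u v \<longrightarrow> S X u v (F X u v)) \<and>
     (\<forall>X u v. \<not> P X u v \<longrightarrow> F X u v = undefined) \<and>
     (\<forall>X Y u v t. P X u v \<and> t \<in> H Y X \<longrightarrow> F Y (ru t u) (rv t v) = rf t (F X u v))}"

text \<open>A translation \<open>(\<alpha>, \<beta>)\<close> of problems and \<open>\<gamma>\<close> of solutions, bijective at each stage and natural, acts on
  uniform choices by conjugation. Stability of problems and solutions under restriction is a condition on
  the source and passes to the target along the translations.\<close>

lemma uniform_solutions_bij:
  fixes \<alpha> :: "'o \<Rightarrow> 'a \<Rightarrow> 'a'" and \<beta> :: "'o \<Rightarrow> 'a \<Rightarrow> 'b \<Rightarrow> 'b'" and \<gamma> :: "'o \<Rightarrow> 'c \<Rightarrow> 'c'"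
  assumes problems: "\<And>X. bij_betw (\<lambda>(u, v). (\<alpha> X u, \<beta> X u v)) {(u, v). P X u v} {(u, v). P' X u v}"
    and solutions: "\<And>X u v. P X u v \<Longrightarrow>
      bij_betw (\<gamma> X) {f. S X u v f} {f. S' X (\<alpha> X u) (\<beta> X u v) f}"
    and restr_problem: "\<And>X Y u v t. P X u v \<Longrightarrow> t \<in> H Y X \<Longrightarrow> P Y (ru t u) (rv t v)"
    and restr_solution: "\<And>X Y u v f t. P X u v \<Longrightarrow> S X u v f \<Longrightarrow> t \<in> H Y X \<Longrightarrow>
      S Y (ru t u) (rv t v) (rf t f)"
    and \<alpha>_natural: "\<And>X Y u v t. P X u v \<Longrightarrow> t \<in> H Y X \<Longrightarrow> \<alpha> Y (ru t u) = ru' t (\<alpha> X u)"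
    and \<beta>_natural: "\<And>X Y u v t. P X u v \<Longrightarrow> t \<in> H Y X \<Longrightarrow>
      \<beta> Y (ru t u) (rv t v) = rv' t (\<beta> X u v)"
    and \<gamma>_natural: "\<And>X Y u v f t. P X u v \<Longrightarrow> S X u v f \<Longrightarrow> t \<in> H Y X \<Longrightarrow>
      \<gamma> Y (rf t f) = rf' t (\<gamma> X f)"
  shows "\<exists>\<Phi>. bij_betw \<Phi> (uniform_solutions P S H ru rv rf) (uniform_solutions P' S' H ru' rv' rf')"
proof -
  let ?U = "uniform_solutions P S H ru rv rf" and ?U' = "uniform_solutions P' S' H ru' rv' rf'"
  define \<delta> where
    "\<delta> X u' v' = inv_into {(u, v). P X u v} (\<lambda>(u, v). (\<alpha> X u, \<beta> X u v)) (u', v')" for X u' v'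
  have \<delta>: "\<delta> X (\<alpha> X u) (\<beta> X u v) = (u, v)" if "P X u v" for X u v
    using inv_into_f_f[OF bij_betw_imp_inj_on[OF problems], of "(u, v)" X] that by (simp add: \<delta>_def)
  have P': "P' X (\<alpha> X u) (\<beta> X u v)" if "P X u v" for X u v
    using bij_betwE[OF problems] that by fastforce
  have P'E: thesis if "P' X u' v'" "\<And>u v. P X u v \<Longrightarrow> u' = \<alpha> X u \<Longrightarrow> v' = \<beta> X u v \<Longrightarrow> thesis"
    for X u' v' thesis
    using bij_betw_imp_surj_on[OF problems, of X] that by (force simp: set_eq_iff image_iff)
  have S': "S' X (\<alpha> X u) (\<beta> X u v) (\<gamma> X f)" if "P X u v" "S X u v f" for X u v f
    using bij_betwE[OF solutions[OF that(1)]] that by blast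
  have S_inj: "f = g" if "P X u v" "S X u v f" "S X u v g" "\<gamma> X f = \<gamma> X g" for X u v f g
    using bij_betw_imp_inj_on[OF solutions[OF that(1)]] that by (auto simp: inj_on_def)
  define \<Phi> where
    "\<Phi> F X u' v' = (if P' X u' v' then \<gamma> X (case \<delta> X u' v' of (u, v) \<Rightarrow> F X u v) else undefined)"
    for F X u' v'
  have \<Phi>: "\<Phi> F X (\<alpha> X u) (\<beta> X u v) = \<gamma> X (F X u v)" if "P X u v" for F X u v
    using that P' \<delta> by (simp add: \<Phi>_def)
  have "\<Phi> F \<in> ?U'" if F: "F \<in> ?U" for F
    unfolding uniform_solutions_def
  proof (intro CollectI conjI allI impI)
    fix X u' v' assume "P' X u' v'"
    then show "S' X u' v' (\<Phi> F X u' v')"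
    proof (rule P'E)
      fix u v assume "P X u v" "u' = \<alpha> X u" "v' = \<beta> X u v"
      then show ?thesis
        using F \<Phi> S' by (simp add: uniform_solutions_def)
    qed
  next
    fix X u' v' assume "\<not> P' X u' v'"
    then show "\<Phi> F X u' v' = undefined" by (simp add: \<Phi>_def)
  next
    fix X Y u' v' t assume t: "P' X u' v' \<and> t \<in> H Y X"
    then have "P' X u' v'" by simp
    then show "\<Phi> F Y (ru' t u') (rv' t v') = rf' t (\<Phi> F X u' v')"
    proof (rule P'E)
      fix u v assume uv: "P X u v" "u' = \<alpha> X u" "v' = \<beta> X u v"
      have "\<Phi> F Y (ru' t u') (rv' t v') = \<Phi> F Y (\<alpha> Y (ru t u)) (\<beta> Y (ru t u) (rv t v))"
        using uv t \<alpha>_natural \<beta>_natural by simp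
      also have "\<dots> = \<gamma> Y (F Y (ru t u) (rv t v))"
        using uv t restr_problem \<Phi> by blast
      also have "\<dots> = rf' t (\<gamma> X (F X u v))"
      proof -
        have "F Y (ru t u) (rv t v) = rf t (F X u v)" "S X u v (F X u v)"
          using uv t F by (simp_all add: uniform_solutions_def)
        then show ?thesis using uv t \<gamma>_natural[of X u v "F X u v" t Y] by simp
      qed
      finally show ?thesis using uv \<Phi> by simp
    qed
  qed
  moreover have "F = G" if F: "F \<in> ?U" "G \<in> ?U" and eq: "\<Phi> F = \<Phi> G" for F G
  proof (intro ext)
    fix X u v
    show "F X u v = G X u v"
    proof (cases "P X u v")
      case True
      then have "\<gamma> X (F X u v) = \<gamma> X (G X u v)"
        using \<Phi> eq by metis
      with True F S_inj show ?thesis by (simp add: uniform_solutions_def)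
    next
      case False
      with F show ?thesis by (simp add: uniform_solutions_def)
    qed
  qed
  moreover have "\<exists>F \<in> ?U. \<Phi> F = F'" if F': "F' \<in> ?U'" for F'
  proof
    \<comment> \<open>Conjugation backwards. Its uniformity holds after applying \<open>\<gamma>\<close>, which is injective on solutions.\<close>
    define F where "F X u v = (if P X u v
      then inv_into {f. S X u v f} (\<gamma> X) (F' X (\<alpha> X u) (\<beta> X u v)) else undefined)" for X u v
    have F: "S X u v (F X u v)" "\<gamma> X (F X u v) = F' X (\<alpha> X u) (\<beta> X u v)" if "P X u v" for X u v
    proof -
      have "F' X (\<alpha> X u) (\<beta> X u v) \<in> \<gamma> X ` {f. S X u v f}"
        using F' P'[OF that] bij_betw_imp_surj_on[OF solutions[OF that]]
        by (simp add: uniform_solutions_def)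
      from inv_into_into[OF this] f_inv_into_f[OF this]
      show "S X u v (F X u v)" "\<gamma> X (F X u v) = F' X (\<alpha> X u) (\<beta> X u v)"
        using that by (simp_all add: F_def)
    qed
    show "F \<in> ?U"
      unfolding uniform_solutions_def
    proof (intro CollectI conjI allI impI)
      fix X Y u v t assume t: "P X u v \<and> t \<in> H Y X"
      then have Y: "P Y (ru t u) (rv t v)" using restr_problem by blast
      show "F Y (ru t u) (rv t v) = rf t (F X u v)"
      proof (rule S_inj[OF Y])
        show "S Y (ru t u) (rv t v) (F Y (ru t u) (rv t v))" using F Y by blast
        show "S Y (ru t u) (rv t v) (rf t (F X u v))" using F t restr_solution by blast
        have "\<gamma> Y (F Y (ru t u) (rv t v)) = F' Y (ru' t (\<alpha> X u)) (rv' t (\<beta> X u v))"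
          using F Y t \<alpha>_natural[of X u v t Y] \<beta>_natural[of X u v t Y] by simp
        also have "\<dots> = rf' t (F' X (\<alpha> X u) (\<beta> X u v))"
          using F' t P' by (simp add: uniform_solutions_def)
        also have "\<dots> = \<gamma> Y (rf t (F X u v))"
          using F t \<gamma>_natural[of X u v "F X u v" t Y] by simp
        finally show "\<gamma> Y (F Y (ru t u) (rv t v)) = \<gamma> Y (rf t (F X u v))" .
      qed
    qed (use F in \<open>simp_all add: F_def\<close>)
    show "\<Phi> F = F'"
    proof (intro ext)
      fix X u' v'
      show "\<Phi> F X u' v' = F' X u' v'"
      proof (cases "P' X u' v'")
        case True
        then show ?thesis by (rule P'E) (simp add: \<Phi> F)
      next
        case False
        with F' show ?thesis by (simp add: \<Phi>_def uniform_solutions_def)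
      qed
    qed
  qed
  ultimately have "bij_betw \<Phi> ?U ?U'"
    unfolding bij_betw_def inj_on_def by blast
  then show ?thesis by blast
qed

section \<open>Maps that represent a pushout-product\<close>

text \<open>Here \<open>Z\<close> stands for the domain or the codomain of \<open>p\<close>. To \<open>Z\<close> the map \<open>k\<close> looks like the
  pushout-product of \<open>i_V\<close> and \<open>i_L\<close>: maps from \<open>K\<close> to \<open>Z\<close>, at every stage \<open>X\<close>, are compatible pairs of
  maps on \<open>\<partial>V \<times> L\<close> and \<open>V \<times> \<partial>L\<close>, and restriction along \<open>k\<close> corresponds to restriction to these two.\<close>

locale pushout_product_at = lex_category C for C :: "('o, 'm) category" (structure) +
  fixes dV V dL L K Z :: 'o and i_V i_L k s :: 'm
  assumes i_V_hom: "i_V \<in> hom C dV V" and i_L_hom: "i_L \<in> hom C dL L"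
    and k_hom: "k \<in> hom C K (V \<otimes> L)"
    and expo [simp]: "exponentiable C dV" "exponentiable C V" "exponentiable C dL" "exponentiable C L"
      "exponentiable C K"
    and Z_Ob [simp]: "Z \<in> Ob C"
    and s_iso: "is_iso C (M_ob C i_V i_L Z) \<lbrakk>K, Z\<rbrakk> s"
    and s_restrict: "s \<cdot> M_restrict C i_V i_L Z = exp_restrict C k Z"
begin

lemma maps [simp]:
  "i_V \<in> Arr C" "Dom C i_V = dV" "Cod C i_V = V"
  "i_L \<in> Arr C" "Dom C i_L = dL" "Cod C i_L = L"
  "k \<in> Arr C" "Dom C k = K" "Cod C k = V \<otimes> L"
  using i_V_hom i_L_hom k_hom by (simp_all add: hom_iff)

abbreviation "r1 \<equiv> leg1 C i_V i_L Z"
abbreviation "r2 \<equiv> leg2 C i_V i_L Z"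
abbreviation "M \<equiv> M_ob C i_V i_L Z"
abbreviation "\<pi>1 \<equiv> pb_proj1 C r1 r2"
abbreviation "\<pi>2 \<equiv> pb_proj2 C r1 r2"

lemma legs [simp]:
  "r1 \<in> Arr C" "Dom C r1 = \<lbrakk>dV \<otimes> L, Z\<rbrakk>" "Cod C r1 = \<lbrakk>dV \<otimes> dL, Z\<rbrakk>"
  "r2 \<in> Arr C" "Dom C r2 = \<lbrakk>V \<otimes> dL, Z\<rbrakk>" "Cod C r2 = \<lbrakk>dV \<otimes> dL, Z\<rbrakk>"
  by (simp_all add: leg1_def leg2_def)

lemma M_proj [simp]:
  "\<pi>1 \<in> Arr C" "Dom C \<pi>1 = M" "Cod C \<pi>1 = \<lbrakk>dV \<otimes> L, Z\<rbrakk>"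
  "\<pi>2 \<in> Arr C" "Dom C \<pi>2 = M" "Cod C \<pi>2 = \<lbrakk>V \<otimes> dL, Z\<rbrakk>"
  by (simp_all add: M_ob_def)

lemma s_arr [simp]: "s \<in> Arr C" "Dom C s = M" "Cod C s = \<lbrakk>K, Z\<rbrakk>"
  using s_iso by (simp_all add: is_iso_def hom_iff)

lemma s_monic:
  assumes "m \<in> Arr C" "m' \<in> Arr C" "Cod C m = M" "Cod C m' = M" "s \<cdot> m = s \<cdot> m'"
  shows "m = m'"
proof -
  obtain r where r: "r \<in> hom C \<lbrakk>K, Z\<rbrakk> M" "r \<cdot> s = \<one> M"
    using s_iso by (auto simp: is_iso_def)
  have "(r \<cdot> s) \<cdot> m = (r \<cdot> s) \<cdot> m'"
    using assms r(1) by (simp add: hom_iff)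
  then show ?thesis using r(2) assms by simp
qed

text \<open>The map to the pullback that corresponds to \<open>u\<close> under \<open>s\<close>. The description by a property gives its
  naturality and its behaviour under composition from the cancellability of \<open>s\<close>.\<close>

definition boundary :: "'o \<Rightarrow> 'm \<Rightarrow> 'm" where
  "boundary X u = (THE m. m \<in> hom C X M \<and> s \<cdot> m = exp_transpose C K X Z u)"

lemma boundary_eqI:
  assumes "m \<in> hom C X M" "s \<cdot> m = exp_transpose C K X Z u"
  shows "boundary X u = m"
  unfolding boundary_def
  using assms by (intro the_equality) (auto simp: hom_iff intro: s_monic)

lemma boundary_arr [simp]:
  assumes "X \<in> Ob C" "u \<in> Arr C" "Dom C u = X \<otimes> K" "Cod C u = Z"
  shows "boundary X u \<in> Arr C" "Dom C (boundary X u) = X" "Cod C (boundary X u) = M"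
    "s \<cdot> boundary X u = exp_transpose C K X Z u"
proof -
  obtain r where r: "r \<in> Arr C" "Dom C r = \<lbrakk>K, Z\<rbrakk>" "Cod C r = M" "s \<cdot> r = \<one> \<lbrakk>K, Z\<rbrakk>"
    using s_iso by (auto simp: is_iso_def hom_iff)
  let ?m = "r \<cdot> exp_transpose C K X Z u"
  have "s \<cdot> ?m = (s \<cdot> r) \<cdot> exp_transpose C K X Z u"
    using assms r(1-3) by simp
  then have m: "?m \<in> hom C X M" "s \<cdot> ?m = exp_transpose C K X Z u"
    using assms r by (simp_all add: hom_iff)
  with boundary_eqI[OF m] show "boundary X u \<in> Arr C" "Dom C (boundary X u) = X"
    "Cod C (boundary X u) = M" "s \<cdot> boundary X u = exp_transpose C K X Z u"
    by (simp_all add: hom_iff)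
qed

definition part1 :: "'o \<Rightarrow> 'm \<Rightarrow> 'm" where
  "part1 X u = untranspose (dV \<otimes> L) X Z (\<pi>1 \<cdot> boundary X u)"

definition part2 :: "'o \<Rightarrow> 'm \<Rightarrow> 'm" where
  "part2 X u = untranspose (V \<otimes> dL) X Z (\<pi>2 \<cdot> boundary X u)"

lemma part_arr [simp]:
  assumes "X \<in> Ob C" "u \<in> Arr C" "Dom C u = X \<otimes> K" "Cod C u = Z"
  shows "part1 X u \<in> Arr C" "Dom C (part1 X u) = X \<otimes> dV \<otimes> L" "Cod C (part1 X u) = Z"
    "exp_transpose C (dV \<otimes> L) X Z (part1 X u) = \<pi>1 \<cdot> boundary X u"
    "part2 X u \<in> Arr C" "Dom C (part2 X u) = X \<otimes> V \<otimes> dL" "Cod C (part2 X u) = Z"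
    "exp_transpose C (V \<otimes> dL) X Z (part2 X u) = \<pi>2 \<cdot> boundary X u"
  using assms by (simp_all add: part1_def part2_def)

lemma part1_eqI:
  assumes "X \<in> Ob C" "a \<in> hom C (X \<otimes> dV \<otimes> L) Z"
    "\<pi>1 \<cdot> boundary X u = exp_transpose C (dV \<otimes> L) X Z a"
  shows "part1 X u = a"
  using assms by (simp add: part1_def untranspose_transpose hom_iff)

lemma part2_eqI:
  assumes "X \<in> Ob C" "b \<in> hom C (X \<otimes> V \<otimes> dL) Z"
    "\<pi>2 \<cdot> boundary X u = exp_transpose C (V \<otimes> dL) X Z b"
  shows "part2 X u = b"
  using assms by (simp add: part2_def untranspose_transpose hom_iff)

text \<open>The legs of the cospan are restriction maps, hence a map into the pullback is a pair that is compatible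
  before transposing.\<close>

lemma transpose_legs:
  assumes "X \<in> Ob C" "a \<in> hom C (X \<otimes> dV \<otimes> L) Z" "b \<in> hom C (X \<otimes> V \<otimes> dL) Z"
  shows "r1 \<cdot> exp_transpose C (dV \<otimes> L) X Z a = r2 \<cdot> exp_transpose C (V \<otimes> dL) X Z b \<longleftrightarrow>
    a \<cdot> (\<one> X \<otimes>\<^sub>m \<one> dV \<otimes>\<^sub>m i_L) = b \<cdot> (\<one> X \<otimes>\<^sub>m i_V \<otimes>\<^sub>m \<one> dL)"
proof -
  have "r1 \<cdot> exp_transpose C (dV \<otimes> L) X Z a =
      exp_transpose C (dV \<otimes> dL) X Z (a \<cdot> (\<one> X \<otimes>\<^sub>m \<one> dV \<otimes>\<^sub>m i_L))"
    using assms unfolding leg1_def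
    by (subst transpose_restrict[where A = "dV \<otimes> dL" and A' = "dV \<otimes> L"]) (simp_all add: hom_iff)
  moreover have "r2 \<cdot> exp_transpose C (V \<otimes> dL) X Z b =
      exp_transpose C (dV \<otimes> dL) X Z (b \<cdot> (\<one> X \<otimes>\<^sub>m i_V \<otimes>\<^sub>m \<one> dL))"
    using assms unfolding leg2_def
    by (subst transpose_restrict[where A = "dV \<otimes> dL" and A' = "V \<otimes> dL"]) (simp_all add: hom_iff)
  ultimately show ?thesis
    using assms by (simp add: transpose_eq_iff hom_iff)
qed

lemma parts_compatible:
  assumes "X \<in> Ob C" "u \<in> hom C (X \<otimes> K) Z"
  shows "part1 X u \<cdot> (\<one> X \<otimes>\<^sub>m \<one> dV \<otimes>\<^sub>m i_L) = part2 X u \<cdot> (\<one> X \<otimes>\<^sub>m i_V \<otimes>\<^sub>m \<one> dL)"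
proof -
  have "r1 \<cdot> (\<pi>1 \<cdot> boundary X u) = r2 \<cdot> (\<pi>2 \<cdot> boundary X u)"
    by (rule pb_commute_Comp) (use assms in \<open>simp_all add: hom_iff M_ob_def[symmetric]\<close>)
  then show ?thesis
    using transpose_legs[of X "part1 X u" "part2 X u"] assms by (simp add: hom_iff)
qed

lemma parts_eq_iff:
  assumes "X \<in> Ob C" "u \<in> hom C (X \<otimes> K) Z" "u' \<in> hom C (X \<otimes> K) Z"
  shows "u = u' \<longleftrightarrow> part1 X u = part1 X u' \<and> part2 X u = part2 X u'"
proof (intro iffI conjI)
  assume parts: "part1 X u = part1 X u' \<and> part2 X u = part2 X u'"
  have "boundary X u = boundary X u'"
  proof (rule pb_arrow_eqI[of r1 r2])
    show "\<pi>1 \<cdot> boundary X u = \<pi>1 \<cdot> boundary X u'"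
      using part_arr(4)[of X u] part_arr(4)[of X u'] assms parts by (simp add: hom_iff)
    show "\<pi>2 \<cdot> boundary X u = \<pi>2 \<cdot> boundary X u'"
      using part_arr(8)[of X u] part_arr(8)[of X u'] assms parts by (simp add: hom_iff)
  qed (use assms in \<open>simp_all add: hom_iff M_ob_def[symmetric]\<close>)
  then have "exp_transpose C K X Z u = exp_transpose C K X Z u'"
    using boundary_arr(4)[of X u] boundary_arr(4)[of X u'] assms by (simp add: hom_iff)
  then show "u = u'"
    using assms by (simp add: transpose_eq_iff)
qed simp_all

lemma ex_parts:
  assumes "X \<in> Ob C" "a \<in> hom C (X \<otimes> dV \<otimes> L) Z" "b \<in> hom C (X \<otimes> V \<otimes> dL) Z"
    and "a \<cdot> (\<one> X \<otimes>\<^sub>m \<one> dV \<otimes>\<^sub>m i_L) = b \<cdot> (\<one> X \<otimes>\<^sub>m i_V \<otimes>\<^sub>m \<one> dL)"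
  obtains u where "u \<in> hom C (X \<otimes> K) Z" "part1 X u = a" "part2 X u = b"
proof
  let ?a = "exp_transpose C (dV \<otimes> L) X Z a" and ?b = "exp_transpose C (V \<otimes> dL) X Z b"
  let ?m = "pb_pairing C r1 r2 ?a ?b"
  have "r1 \<cdot> ?a = r2 \<cdot> ?b" using assms transpose_legs by blast
  then have m: "?m \<in> Arr C" "Dom C ?m = X" "Cod C ?m = M" "\<pi>1 \<cdot> ?m = ?a" "\<pi>2 \<cdot> ?m = ?b"
    using pb_pairing_arr[of r1 r2 ?a ?b] assms by (simp_all add: hom_iff M_ob_def)
  let ?u = "untranspose K X Z (s \<cdot> ?m)"
  show "?u \<in> hom C (X \<otimes> K) Z" using m by (simp add: hom_iff)
  have "boundary X ?u = ?m"
    using m by (intro boundary_eqI) (simp_all add: hom_iff)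
  with m assms show "part1 X ?u = a" "part2 X ?u = b"
    by (simp_all add: part1_eqI part2_eqI)
qed

lemma boundary_pre_Comp:
  assumes "t \<in> hom C Y X" "u \<in> hom C (X \<otimes> K) Z"
  shows "boundary Y (u \<cdot> (t \<otimes>\<^sub>m \<one> K)) = boundary X u \<cdot> t"
proof (rule boundary_eqI)
  have X: "X \<in> Ob C" using assms by (auto simp: hom_iff)
  then show "boundary X u \<cdot> t \<in> hom C Y M" using assms by (simp add: hom_iff)
  have "(s \<cdot> boundary X u) \<cdot> t = exp_transpose C K Y Z (u \<cdot> (t \<otimes>\<^sub>m \<one> K))"
    using assms X by (simp add: transpose_pre_Comp[where X = X] hom_iff del: Comp_assoc_simp)
  then show "s \<cdot> (boundary X u \<cdot> t) = exp_transpose C K Y Z (u \<cdot> (t \<otimes>\<^sub>m \<one> K))"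
    using assms X by (simp add: hom_iff del: boundary_arr(4))
qed

lemma parts_pre_Comp:
  assumes "t \<in> hom C Y X" "u \<in> hom C (X \<otimes> K) Z"
  shows "part1 Y (u \<cdot> (t \<otimes>\<^sub>m \<one> K)) = part1 X u \<cdot> (t \<otimes>\<^sub>m \<one> (dV \<otimes> L))"
    "part2 Y (u \<cdot> (t \<otimes>\<^sub>m \<one> K)) = part2 X u \<cdot> (t \<otimes>\<^sub>m \<one> (V \<otimes> dL))"
proof -
  have Ob: "X \<in> Ob C" "Y \<in> Ob C" using assms by (auto simp: hom_iff)
  show "part1 Y (u \<cdot> (t \<otimes>\<^sub>m \<one> K)) = part1 X u \<cdot> (t \<otimes>\<^sub>m \<one> (dV \<otimes> L))"
    using assms Ob
    by (intro part1_eqI) (simp_all add: boundary_pre_Comp transpose_pre_Comp[where X = X] hom_iff)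
  show "part2 Y (u \<cdot> (t \<otimes>\<^sub>m \<one> K)) = part2 X u \<cdot> (t \<otimes>\<^sub>m \<one> (V \<otimes> dL))"
    using assms Ob
    by (intro part2_eqI) (simp_all add: boundary_pre_Comp transpose_pre_Comp[where X = X] hom_iff)
qed

lemma M_restrict_arr [simp]:
  "M_restrict C i_V i_L Z \<in> Arr C" "Dom C (M_restrict C i_V i_L Z) = \<lbrakk>V \<otimes> L, Z\<rbrakk>"
  "Cod C (M_restrict C i_V i_L Z) = M"
  "\<pi>1 \<cdot> M_restrict C i_V i_L Z = exp_restrict C (i_V \<otimes>\<^sub>m \<one> L) Z"
  "\<pi>2 \<cdot> M_restrict C i_V i_L Z = exp_restrict C (\<one> V \<otimes>\<^sub>m i_L) Z"
proof -
  have "r1 \<cdot> exp_restrict C (i_V \<otimes>\<^sub>m \<one> L) Z = r2 \<cdot> exp_restrict C (\<one> V \<otimes>\<^sub>m i_L) Z"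
    by (simp add: leg1_def leg2_def
        exp_restrict_Comp[where A = "dV \<otimes> dL" and A' = "dV \<otimes> L" and A'' = "V \<otimes> L"]
        exp_restrict_Comp[where A = "dV \<otimes> dL" and A' = "V \<otimes> dL" and A'' = "V \<otimes> L"])
  from pb_pairing_arr[OF _ _ _ _ _ _ _ _ this]
  show "M_restrict C i_V i_L Z \<in> Arr C" "Dom C (M_restrict C i_V i_L Z) = \<lbrakk>V \<otimes> L, Z\<rbrakk>"
    "Cod C (M_restrict C i_V i_L Z) = M"
    "\<pi>1 \<cdot> M_restrict C i_V i_L Z = exp_restrict C (i_V \<otimes>\<^sub>m \<one> L) Z"
    "\<pi>2 \<cdot> M_restrict C i_V i_L Z = exp_restrict C (\<one> V \<otimes>\<^sub>m i_L) Z"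
    by (simp_all add: M_restrict_def M_ob_def)
qed

text \<open>Because restriction along \<open>k\<close> factors through \<open>M_restrict\<close>, the boundary of \<open>f \<cdot> (X \<times> k)\<close> is the transpose
  of \<open>f\<close> followed by \<open>M_restrict\<close>, whose components are the two restriction maps.\<close>

lemma parts_of_restriction:
  assumes "X \<in> Ob C" "f \<in> hom C (X \<otimes> V \<otimes> L) Z"
  shows "part1 X (f \<cdot> (\<one> X \<otimes>\<^sub>m k)) = f \<cdot> (\<one> X \<otimes>\<^sub>m i_V \<otimes>\<^sub>m \<one> L)"
    "part2 X (f \<cdot> (\<one> X \<otimes>\<^sub>m k)) = f \<cdot> (\<one> X \<otimes>\<^sub>m \<one> V \<otimes>\<^sub>m i_L)"
proof -
  let ?R = "M_restrict C i_V i_L Z" and ?f = "exp_transpose C (V \<otimes> L) X Z f"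
  have b: "boundary X (f \<cdot> (\<one> X \<otimes>\<^sub>m k)) = ?R \<cdot> ?f"
  proof (rule boundary_eqI)
    show "?R \<cdot> ?f \<in> hom C X M" using assms by (simp add: hom_iff)
    have "(s \<cdot> ?R) \<cdot> ?f = exp_transpose C K X Z (f \<cdot> (\<one> X \<otimes>\<^sub>m k))"
      using assms by (simp add: s_restrict transpose_restrict[where A' = "V \<otimes> L"] hom_iff)
    then show "s \<cdot> (?R \<cdot> ?f) = exp_transpose C K X Z (f \<cdot> (\<one> X \<otimes>\<^sub>m k))"
      using assms by (simp add: hom_iff)
  qed
  have "\<pi>1 \<cdot> (?R \<cdot> ?f) = (\<pi>1 \<cdot> ?R) \<cdot> ?f" "\<pi>2 \<cdot> (?R \<cdot> ?f) = (\<pi>2 \<cdot> ?R) \<cdot> ?f"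
    using assms by (simp_all add: hom_iff del: M_restrict_arr(4,5))
  then have "\<pi>1 \<cdot> (?R \<cdot> ?f) = exp_transpose C (dV \<otimes> L) X Z (f \<cdot> (\<one> X \<otimes>\<^sub>m i_V \<otimes>\<^sub>m \<one> L))"
    "\<pi>2 \<cdot> (?R \<cdot> ?f) = exp_transpose C (V \<otimes> dL) X Z (f \<cdot> (\<one> X \<otimes>\<^sub>m \<one> V \<otimes>\<^sub>m i_L))"
    using assms by (simp_all add: transpose_restrict[where A' = "V \<otimes> L"] hom_iff)
  with b show "part1 X (f \<cdot> (\<one> X \<otimes>\<^sub>m k)) = f \<cdot> (\<one> X \<otimes>\<^sub>m i_V \<otimes>\<^sub>m \<one> L)"
    "part2 X (f \<cdot> (\<one> X \<otimes>\<^sub>m k)) = f \<cdot> (\<one> X \<otimes>\<^sub>m \<one> V \<otimes>\<^sub>m i_L)"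
    using assms by (simp_all add: part1_eqI part2_eqI hom_iff)
qed

end

section \<open>Restricted lifting against a pullback-power\<close>

locale pushout_product_approximation = lex_category C +
    E: pushout_product_at C dV V dL L K E i_V i_L k s_E +
    B: pushout_product_at C dV V dL L K B i_V i_L k s_B
  for C :: "('o, 'm) category" (structure)
    and dV V dL L K E B i_V i_L k s_E s_B +
  fixes L' :: 'o and p l :: 'm
  assumes p_hom: "p \<in> hom C E B" and l_hom: "l \<in> hom C L L'"
    and expo_L' [simp]: "exponentiable C L'"
    and s_natural: "exp_map C K p \<cdot> s_E = s_B \<cdot> M_map C i_V i_L p"
begin

lemma p_l [simp]:
  "p \<in> Arr C" "Dom C p = E" "Cod C p = B" "l \<in> Arr C" "Dom C l = L" "Cod C l = L'"
  using p_hom l_hom by (simp_all add: hom_iff)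

lemma M_map_arr [simp]:
  "M_map C i_V i_L p \<in> Arr C" "Dom C (M_map C i_V i_L p) = E.M" "Cod C (M_map C i_V i_L p) = B.M"
  "B.\<pi>1 \<cdot> M_map C i_V i_L p = exp_map C (dV \<otimes> L) p \<cdot> E.\<pi>1"
  "B.\<pi>2 \<cdot> M_map C i_V i_L p = exp_map C (V \<otimes> dL) p \<cdot> E.\<pi>2"
proof -
  have "B.r1 \<cdot> exp_map C (dV \<otimes> L) p = exp_map C (dV \<otimes> dL) p \<cdot> E.r1"
    unfolding leg1_def by (rule exp_restrict_natural) simp_all
  then have 1: "B.r1 \<cdot> (exp_map C (dV \<otimes> L) p \<cdot> E.\<pi>1) = exp_map C (dV \<otimes> dL) p \<cdot> (E.r1 \<cdot> E.\<pi>1)"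
    using Comp_assoc_simp[of E.\<pi>1 "exp_map C (dV \<otimes> L) p" B.r1] by simp
  have "B.r2 \<cdot> exp_map C (V \<otimes> dL) p = exp_map C (dV \<otimes> dL) p \<cdot> E.r2"
    unfolding leg2_def by (rule exp_restrict_natural) simp_all
  then have "B.r2 \<cdot> (exp_map C (V \<otimes> dL) p \<cdot> E.\<pi>2) = exp_map C (dV \<otimes> dL) p \<cdot> (E.r2 \<cdot> E.\<pi>2)"
    using Comp_assoc_simp[of E.\<pi>2 "exp_map C (V \<otimes> dL) p" B.r2] by simp
  with 1 have "B.r1 \<cdot> (exp_map C (dV \<otimes> L) p \<cdot> E.\<pi>1) = B.r2 \<cdot> (exp_map C (V \<otimes> dL) p \<cdot> E.\<pi>2)"
    using pb_commute[of E.r1 E.r2] by simp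
  then show "M_map C i_V i_L p \<in> Arr C" "Dom C (M_map C i_V i_L p) = E.M"
    "Cod C (M_map C i_V i_L p) = B.M"
    "B.\<pi>1 \<cdot> M_map C i_V i_L p = exp_map C (dV \<otimes> L) p \<cdot> E.\<pi>1"
    "B.\<pi>2 \<cdot> M_map C i_V i_L p = exp_map C (V \<otimes> dL) p \<cdot> E.\<pi>2"
    using pb_pairing_arr[of B.r1 B.r2 "exp_map C (dV \<otimes> L) p \<cdot> E.\<pi>1" "exp_map C (V \<otimes> dL) p \<cdot> E.\<pi>2"]
    by (simp_all add: M_map_def M_ob_def[symmetric])
qed

text \<open>The isomorphism \<open>s_B\<close> may be cancelled from the compatibility of \<open>s_E\<close> and \<open>s_B\<close> with \<open>[K, p]\<close>.\<close>

lemma boundary_post_Comp: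
  assumes "X \<in> Ob C" "u \<in> hom C (X \<otimes> K) E"
  shows "B.boundary X (p \<cdot> u) = M_map C i_V i_L p \<cdot> E.boundary X u"
proof (rule B.boundary_eqI)
  show "M_map C i_V i_L p \<cdot> E.boundary X u \<in> hom C X B.M"
    using assms by (simp add: hom_iff)
  have "s_B \<cdot> (M_map C i_V i_L p \<cdot> E.boundary X u) = (exp_map C K p \<cdot> s_E) \<cdot> E.boundary X u"
    unfolding s_natural using assms by (simp add: hom_iff)
  also have "\<dots> = exp_transpose C K X B (p \<cdot> u)"
    using assms by (simp add: transpose_post_Comp[where Y = E] hom_iff)
  finally show "s_B \<cdot> (M_map C i_V i_L p \<cdot> E.boundary X u) = exp_transpose C K X B (p \<cdot> u)" .
qed

lemma parts_post_Comp:
  assumes "X \<in> Ob C" "u \<in> hom C (X \<otimes> K) E"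
  shows "B.part1 X (p \<cdot> u) = p \<cdot> E.part1 X u" "B.part2 X (p \<cdot> u) = p \<cdot> E.part2 X u"
proof -
  let ?m = "M_map C i_V i_L p \<cdot> E.boundary X u"
  have "B.\<pi>1 \<cdot> ?m = (B.\<pi>1 \<cdot> M_map C i_V i_L p) \<cdot> E.boundary X u"
    "B.\<pi>2 \<cdot> ?m = (B.\<pi>2 \<cdot> M_map C i_V i_L p) \<cdot> E.boundary X u"
    using assms by (simp_all add: hom_iff del: M_map_arr(4,5))
  then have "B.\<pi>1 \<cdot> ?m = exp_transpose C (dV \<otimes> L) X B (p \<cdot> E.part1 X u)"
    "B.\<pi>2 \<cdot> ?m = exp_transpose C (V \<otimes> dL) X B (p \<cdot> E.part2 X u)"
    using assms by (simp_all add: transpose_post_Comp[where Y = E] hom_iff)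
  then show "B.part1 X (p \<cdot> u) = p \<cdot> E.part1 X u" "B.part2 X (p \<cdot> u) = p \<cdot> E.part2 X u"
    using assms by (simp_all add: B.part1_eqI B.part2_eqI boundary_post_Comp hom_iff)
qed

text \<open>Since maps from \<open>X \<times> K\<close> to \<open>B\<close> are determined by their parts, the square that defines a left problem
  splits into one equation for each part.\<close>

lemma left_problem_iff:
  "left_problem C k (\<one> V \<otimes>\<^sub>m l) p X u c \<longleftrightarrow>
    X \<in> Ob C \<and> u \<in> hom C (X \<otimes> K) E \<and> c \<in> hom C (X \<otimes> V \<otimes> L') B \<and>
    p \<cdot> E.part1 X u = c \<cdot> (\<one> X \<otimes>\<^sub>m i_V \<otimes>\<^sub>m l) \<and>
    p \<cdot> E.part2 X u = c \<cdot> (\<one> X \<otimes>\<^sub>m \<one> V \<otimes>\<^sub>m (l \<cdot> i_L))"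
proof -
  have "p \<cdot> u = c \<cdot> (\<one> X \<otimes>\<^sub>m \<one> V \<otimes>\<^sub>m l) \<cdot> (\<one> X \<otimes>\<^sub>m k) \<longleftrightarrow>
      p \<cdot> E.part1 X u = c \<cdot> (\<one> X \<otimes>\<^sub>m i_V \<otimes>\<^sub>m l) \<and>
      p \<cdot> E.part2 X u = c \<cdot> (\<one> X \<otimes>\<^sub>m \<one> V \<otimes>\<^sub>m (l \<cdot> i_L))"
    if "X \<in> Ob C" "u \<in> hom C (X \<otimes> K) E" "c \<in> hom C (X \<otimes> V \<otimes> L') B"
  proof -
    let ?f = "c \<cdot> (\<one> X \<otimes>\<^sub>m \<one> V \<otimes>\<^sub>m l)"
    have f: "?f \<in> hom C (X \<otimes> V \<otimes> L) B" using that by (simp add: hom_iff)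
    have "p \<cdot> u = ?f \<cdot> (\<one> X \<otimes>\<^sub>m k) \<longleftrightarrow>
        p \<cdot> E.part1 X u = ?f \<cdot> (\<one> X \<otimes>\<^sub>m i_V \<otimes>\<^sub>m \<one> L) \<and>
        p \<cdot> E.part2 X u = ?f \<cdot> (\<one> X \<otimes>\<^sub>m \<one> V \<otimes>\<^sub>m i_L)"
      unfolding parts_post_Comp[OF that(1,2), symmetric] B.parts_of_restriction[OF that(1) f, symmetric]
      by (rule B.parts_eq_iff) (use that in \<open>simp_all add: hom_iff\<close>)
    then show ?thesis using that by (simp add: hom_iff)
  qed
  then show ?thesis
    unfolding left_problem_def by auto
qed

lemma left_solution_iff:
  assumes "X \<in> Ob C" "u \<in> hom C (X \<otimes> K) E"
  shows "left_solution C k (\<one> V \<otimes>\<^sub>m l) p X u c f \<longleftrightarrow>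
    f \<in> hom C (X \<otimes> V \<otimes> L) E \<and> f \<cdot> (\<one> X \<otimes>\<^sub>m i_V \<otimes>\<^sub>m \<one> L) = E.part1 X u \<and>
    f \<cdot> (\<one> X \<otimes>\<^sub>m \<one> V \<otimes>\<^sub>m i_L) = E.part2 X u \<and> p \<cdot> f = c \<cdot> (\<one> X \<otimes>\<^sub>m \<one> V \<otimes>\<^sub>m l)"
proof -
  have "f \<cdot> (\<one> X \<otimes>\<^sub>m k) = u \<longleftrightarrow> f \<cdot> (\<one> X \<otimes>\<^sub>m i_V \<otimes>\<^sub>m \<one> L) = E.part1 X u \<and>
    f \<cdot> (\<one> X \<otimes>\<^sub>m \<one> V \<otimes>\<^sub>m i_L) = E.part2 X u" if f: "f \<in> hom C (X \<otimes> V \<otimes> L) E"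
    unfolding E.parts_of_restriction[OF assms(1) f, symmetric]
    by (rule E.parts_eq_iff) (use assms f in \<open>simp_all add: hom_iff\<close>)
  then show ?thesis unfolding left_solution_def by auto
qed

abbreviation "E_leg \<equiv> exp_map C dL p"
abbreviation "B_leg \<equiv> exp_restrict C i_L B"
abbreviation "B_leg' \<equiv> exp_restrict C (l \<cdot> i_L) B"
abbreviation "P \<equiv> pb_ob C E_leg B_leg"
abbreviation "P' \<equiv> pb_ob C E_leg B_leg'"
abbreviation "p_hat \<equiv> pullback_power C i_L p"
abbreviation "q \<equiv> power_restrict C i_L l p"

lemma p_hat_arr [simp]:
  "p_hat \<in> Arr C" "Dom C p_hat = \<lbrakk>L, E\<rbrakk>" "Cod C p_hat = P"
  "pb_proj1 C E_leg B_leg \<cdot> p_hat = exp_restrict C i_L E"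
  "pb_proj2 C E_leg B_leg \<cdot> p_hat = exp_map C L p"
proof -
  have "E_leg \<cdot> exp_restrict C i_L E = B_leg \<cdot> exp_map C L p"
    by (rule exp_restrict_natural[symmetric]) simp_all
  then show "p_hat \<in> Arr C" "Dom C p_hat = \<lbrakk>L, E\<rbrakk>" "Cod C p_hat = P"
    "pb_proj1 C E_leg B_leg \<cdot> p_hat = exp_restrict C i_L E"
    "pb_proj2 C E_leg B_leg \<cdot> p_hat = exp_map C L p"
    using pb_pairing_arr[of E_leg B_leg "exp_restrict C i_L E" "exp_map C L p"]
    by (simp_all add: pullback_power_def)
qed

lemma q_arr [simp]:
  "q \<in> Arr C" "Dom C q = P'" "Cod C q = P"
  "pb_proj1 C E_leg B_leg \<cdot> q = pb_proj1 C E_leg B_leg'"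
  "pb_proj2 C E_leg B_leg \<cdot> q = exp_restrict C l B \<cdot> pb_proj2 C E_leg B_leg'"
proof -
  have "B_leg \<cdot> exp_restrict C l B = B_leg'"
    by (rule exp_restrict_Comp) simp_all
  then have "B_leg \<cdot> (exp_restrict C l B \<cdot> pb_proj2 C E_leg B_leg') = B_leg' \<cdot> pb_proj2 C E_leg B_leg'"
    using Comp_assoc_simp[of "pb_proj2 C E_leg B_leg'" "exp_restrict C l B" B_leg] by simp
  then have "E_leg \<cdot> pb_proj1 C E_leg B_leg' = B_leg \<cdot> (exp_restrict C l B \<cdot> pb_proj2 C E_leg B_leg')"
    using pb_commute[of E_leg B_leg'] by simp
  then show "q \<in> Arr C" "Dom C q = P'" "Cod C q = P"
    "pb_proj1 C E_leg B_leg \<cdot> q = pb_proj1 C E_leg B_leg'"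
    "pb_proj2 C E_leg B_leg \<cdot> q = exp_restrict C l B \<cdot> pb_proj2 C E_leg B_leg'"
    using pb_pairing_arr[of E_leg B_leg "pb_proj1 C E_leg B_leg'" "exp_restrict C l B \<cdot> pb_proj2 C E_leg B_leg'"]
    by (simp_all add: power_restrict_def)
qed

text \<open>Maps from \<open>X \<times> V\<close> to the domain of \<open>q\<close> are exactly these, for \<open>b\<close> and \<open>c\<close> subject to the condition of
  \<open>glue_compatible\<close>.\<close>

definition glue :: "'o \<Rightarrow> 'm \<Rightarrow> 'm \<Rightarrow> 'm" where
  "glue X b c = pb_pairing C E_leg B_leg' (curry_last X V dL E b) (curry_last X V L' B c)"

lemma glue_compatible:
  assumes "X \<in> Ob C" "b \<in> hom C (X \<otimes> V \<otimes> dL) E" "c \<in> hom C (X \<otimes> V \<otimes> L') B"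
  shows "E_leg \<cdot> curry_last X V dL E b = B_leg' \<cdot> curry_last X V L' B c \<longleftrightarrow>
    p \<cdot> b = c \<cdot> (\<one> X \<otimes>\<^sub>m \<one> V \<otimes>\<^sub>m (l \<cdot> i_L))"
proof -
  have "E_leg \<cdot> curry_last X V dL E b = curry_last X V dL B (p \<cdot> b)"
    using assms by (intro curry_last_post_Comp[symmetric]) (simp_all add: hom_iff)
  moreover have "B_leg' \<cdot> curry_last X V L' B c = curry_last X V dL B (c \<cdot> (\<one> X \<otimes>\<^sub>m \<one> V \<otimes>\<^sub>m (l \<cdot> i_L)))"
    using assms by (intro curry_last_restrict[symmetric]) (simp_all add: hom_iff)
  ultimately show ?thesis
    using assms by (simp add: curry_last_eq_iff hom_iff)
qed

lemma glue_arr: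
  assumes "X \<in> Ob C" "b \<in> hom C (X \<otimes> V \<otimes> dL) E" "c \<in> hom C (X \<otimes> V \<otimes> L') B"
    and "p \<cdot> b = c \<cdot> (\<one> X \<otimes>\<^sub>m \<one> V \<otimes>\<^sub>m (l \<cdot> i_L))"
  shows "glue X b c \<in> Arr C" "Dom C (glue X b c) = X \<otimes> V" "Cod C (glue X b c) = P'"
    "pb_proj1 C E_leg B_leg' \<cdot> glue X b c = curry_last X V dL E b"
    "pb_proj2 C E_leg B_leg' \<cdot> glue X b c = curry_last X V L' B c"
  using pb_pairing_arr[of E_leg B_leg' "curry_last X V dL E b" "curry_last X V L' B c"]
    glue_compatible[OF assms(1-3)] assms
  by (simp_all add: glue_def hom_iff)

lemma ex_glue:
  assumes "X \<in> Ob C" "v \<in> hom C (X \<otimes> V) P'"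
  obtains b c where "b \<in> hom C (X \<otimes> V \<otimes> dL) E" "c \<in> hom C (X \<otimes> V \<otimes> L') B"
    "p \<cdot> b = c \<cdot> (\<one> X \<otimes>\<^sub>m \<one> V \<otimes>\<^sub>m (l \<cdot> i_L))" "v = glue X b c"
proof -
  have v: "v \<in> Arr C" "Dom C v = X \<otimes> V" "Cod C v = P'" using assms by (simp_all add: hom_iff)
  obtain b where b: "b \<in> hom C (X \<otimes> V \<otimes> dL) E" "curry_last X V dL E b = pb_proj1 C E_leg B_leg' \<cdot> v"
    by (rule curry_last_surj[of dL X V E "pb_proj1 C E_leg B_leg' \<cdot> v"])
      (use assms(1) v in \<open>simp_all add: hom_iff\<close>)
  obtain c where c: "c \<in> hom C (X \<otimes> V \<otimes> L') B" "curry_last X V L' B c = pb_proj2 C E_leg B_leg' \<cdot> v"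
    by (rule curry_last_surj[of L' X V B "pb_proj2 C E_leg B_leg' \<cdot> v"])
      (use assms(1) v in \<open>simp_all add: hom_iff\<close>)
  have "E_leg \<cdot> (pb_proj1 C E_leg B_leg' \<cdot> v) = B_leg' \<cdot> (pb_proj2 C E_leg B_leg' \<cdot> v)"
    by (rule pb_commute_Comp) (use v in simp_all)
  then have eq: "p \<cdot> b = c \<cdot> (\<one> X \<otimes>\<^sub>m \<one> V \<otimes>\<^sub>m (l \<cdot> i_L))"
    using glue_compatible[OF assms(1) b(1) c(1)] b(2) c(2) by simp
  have "v = glue X b c"
    by (rule pb_arrow_eqI[of E_leg B_leg'])
      (use v b c glue_arr[OF assms(1) b(1) c(1) eq] in \<open>simp_all add: hom_iff\<close>)
  with b c eq that show thesis by blast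
qed

lemma p_hat_eq_iff:
  assumes "g \<in> hom C Y \<lbrakk>L, E\<rbrakk>" "v \<in> hom C Y P'"
  shows "p_hat \<cdot> g = q \<cdot> v \<longleftrightarrow>
    exp_restrict C i_L E \<cdot> g = pb_proj1 C E_leg B_leg' \<cdot> v \<and>
    exp_map C L p \<cdot> g = exp_restrict C l B \<cdot> (pb_proj2 C E_leg B_leg' \<cdot> v)"
proof -
  have "pb_proj1 C E_leg B_leg \<cdot> (p_hat \<cdot> g) = (pb_proj1 C E_leg B_leg \<cdot> p_hat) \<cdot> g"
    "pb_proj2 C E_leg B_leg \<cdot> (p_hat \<cdot> g) = (pb_proj2 C E_leg B_leg \<cdot> p_hat) \<cdot> g"
    "pb_proj1 C E_leg B_leg \<cdot> (q \<cdot> v) = (pb_proj1 C E_leg B_leg \<cdot> q) \<cdot> v"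
    "pb_proj2 C E_leg B_leg \<cdot> (q \<cdot> v) = (pb_proj2 C E_leg B_leg \<cdot> q) \<cdot> v"
    using assms by (simp_all add: hom_iff del: p_hat_arr(4,5) q_arr(4,5))
  then show ?thesis
    using assms by (subst pb_arrow_eq_iff[of E_leg B_leg]) (simp_all add: hom_iff)
qed

text \<open>An equation between maps into the codomain of \<open>p_hat\<close> has two components. At \<open>[\<partial>L, E]\<close> it says that \<open>a\<close>
  and \<open>b\<close> agree, at \<open>[L, B]\<close> that \<open>a\<close> lies over \<open>c\<close>.\<close>

lemma right_problem_glue_iff:
  assumes X: "X \<in> Ob C" and a: "a \<in> hom C (X \<otimes> dV \<otimes> L) E" and b: "b \<in> hom C (X \<otimes> V \<otimes> dL) E"
    and c: "c \<in> hom C (X \<otimes> V \<otimes> L') B" and bc: "p \<cdot> b = c \<cdot> (\<one> X \<otimes>\<^sub>m \<one> V \<otimes>\<^sub>m (l \<cdot> i_L))"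
  shows "right_problem C i_V p_hat q X (curry_last X dV L E a) (glue X b c) \<longleftrightarrow>
    a \<cdot> (\<one> X \<otimes>\<^sub>m \<one> dV \<otimes>\<^sub>m i_L) = b \<cdot> (\<one> X \<otimes>\<^sub>m i_V \<otimes>\<^sub>m \<one> dL) \<and>
    p \<cdot> a = c \<cdot> (\<one> X \<otimes>\<^sub>m i_V \<otimes>\<^sub>m l)"
proof -
  let ?a = "curry_last X dV L E a" and ?v = "glue X b c" and ?i = "\<one> X \<otimes>\<^sub>m i_V"
  note v = glue_arr[OF X b c bc]
  have abc: "a \<in> Arr C" "Dom C a = X \<otimes> dV \<otimes> L" "Cod C a = E" "b \<in> Arr C" "Dom C b = X \<otimes> V \<otimes> dL"
    "Cod C b = E" "c \<in> Arr C" "Dom C c = X \<otimes> V \<otimes> L'" "Cod C c = B"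
    using a b c by (simp_all add: hom_iff)
  have a1: "exp_restrict C i_L E \<cdot> ?a = curry_last X dV dL E (a \<cdot> (\<one> X \<otimes>\<^sub>m \<one> dV \<otimes>\<^sub>m i_L))"
    by (rule curry_last_restrict[symmetric]) (simp_all add: X abc)
  have a2: "exp_map C L p \<cdot> ?a = curry_last X dV L B (p \<cdot> a)"
    by (rule curry_last_post_Comp[symmetric]) (simp_all add: X abc)
  have "pb_proj1 C E_leg B_leg' \<cdot> (?v \<cdot> ?i) = (pb_proj1 C E_leg B_leg' \<cdot> ?v) \<cdot> ?i"
    using X v(1-3) by simp
  also have "\<dots> = curry_last X dV dL E (b \<cdot> (\<one> X \<otimes>\<^sub>m i_V \<otimes>\<^sub>m \<one> dL))"
    unfolding v(4) by (rule curry_last_pre_Comp[symmetric]) (simp_all add: X abc)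
  finally have v1: "pb_proj1 C E_leg B_leg' \<cdot> (?v \<cdot> ?i) = curry_last X dV dL E (b \<cdot> (\<one> X \<otimes>\<^sub>m i_V \<otimes>\<^sub>m \<one> dL))" .
  have "exp_restrict C l B \<cdot> (pb_proj2 C E_leg B_leg' \<cdot> (?v \<cdot> ?i)) =
      exp_restrict C l B \<cdot> ((pb_proj2 C E_leg B_leg' \<cdot> ?v) \<cdot> ?i)"
    using X v(1-3) by simp
  also have "(pb_proj2 C E_leg B_leg' \<cdot> ?v) \<cdot> ?i = curry_last X dV L' B (c \<cdot> (\<one> X \<otimes>\<^sub>m i_V \<otimes>\<^sub>m \<one> L'))"
    unfolding v(5) by (rule curry_last_pre_Comp[symmetric]) (simp_all add: X abc)
  also have "exp_restrict C l B \<cdot> \<dots> =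
      curry_last X dV L B ((c \<cdot> (\<one> X \<otimes>\<^sub>m i_V \<otimes>\<^sub>m \<one> L')) \<cdot> (\<one> X \<otimes>\<^sub>m \<one> dV \<otimes>\<^sub>m l))"
    by (rule curry_last_restrict[symmetric]) (simp_all add: X abc)
  also have "\<dots> = curry_last X dV L B (c \<cdot> (\<one> X \<otimes>\<^sub>m i_V \<otimes>\<^sub>m l))"
    by (simp add: X abc)
  finally have v2: "exp_restrict C l B \<cdot> (pb_proj2 C E_leg B_leg' \<cdot> (?v \<cdot> ?i)) = \<dots>" .
  have "p_hat \<cdot> ?a = q \<cdot> (?v \<cdot> ?i) \<longleftrightarrow>
      a \<cdot> (\<one> X \<otimes>\<^sub>m \<one> dV \<otimes>\<^sub>m i_L) = b \<cdot> (\<one> X \<otimes>\<^sub>m i_V \<otimes>\<^sub>m \<one> dL) \<and> p \<cdot> a = c \<cdot> (\<one> X \<otimes>\<^sub>m i_V \<otimes>\<^sub>m l)"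
    by (subst p_hat_eq_iff[where Y = "X \<otimes> dV"])
      (simp_all add: a1 a2 v1 v2 curry_last_eq_iff X abc v(1-3) hom_iff)
  then show ?thesis
    unfolding right_problem_def by (simp add: X abc v(1-3) hom_iff)
qed

text \<open>The component at \<open>[\<partial>L, E]\<close> of the lower triangle gives the restriction of \<open>f\<close> to \<open>b\<close>; the upper triangle
  gives its restriction to \<open>a\<close>. This is the same condition as in \<open>left_solution_iff\<close>.\<close>

lemma right_solution_glue_iff:
  assumes X: "X \<in> Ob C" and a: "a \<in> hom C (X \<otimes> dV \<otimes> L) E" and b: "b \<in> hom C (X \<otimes> V \<otimes> dL) E"
    and c: "c \<in> hom C (X \<otimes> V \<otimes> L') B" and bc: "p \<cdot> b = c \<cdot> (\<one> X \<otimes>\<^sub>m \<one> V \<otimes>\<^sub>m (l \<cdot> i_L))"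
    and f: "f \<in> hom C (X \<otimes> V \<otimes> L) E"
  shows "right_solution C i_V p_hat q X (curry_last X dV L E a) (glue X b c) (curry_last X V L E f) \<longleftrightarrow>
    f \<cdot> (\<one> X \<otimes>\<^sub>m i_V \<otimes>\<^sub>m \<one> L) = a \<and> f \<cdot> (\<one> X \<otimes>\<^sub>m \<one> V \<otimes>\<^sub>m i_L) = b \<and>
    p \<cdot> f = c \<cdot> (\<one> X \<otimes>\<^sub>m \<one> V \<otimes>\<^sub>m l)"
proof -
  let ?f = "curry_last X V L E f" and ?v = "glue X b c" and ?i = "\<one> X \<otimes>\<^sub>m i_V"
  note v = glue_arr[OF X b c bc]
  have abc: "a \<in> Arr C" "Dom C a = X \<otimes> dV \<otimes> L" "Cod C a = E" "b \<in> Arr C" "Dom C b = X \<otimes> V \<otimes> dL"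
    "Cod C b = E" "c \<in> Arr C" "Dom C c = X \<otimes> V \<otimes> L'" "Cod C c = B"
    "f \<in> Arr C" "Dom C f = X \<otimes> V \<otimes> L" "Cod C f = E"
    using a b c f by (simp_all add: hom_iff)
  have f0: "?f \<cdot> ?i = curry_last X dV L E (f \<cdot> (\<one> X \<otimes>\<^sub>m i_V \<otimes>\<^sub>m \<one> L))"
    by (rule curry_last_pre_Comp[symmetric]) (simp_all add: X abc)
  have f1: "exp_restrict C i_L E \<cdot> ?f = curry_last X V dL E (f \<cdot> (\<one> X \<otimes>\<^sub>m \<one> V \<otimes>\<^sub>m i_L))"
    by (rule curry_last_restrict[symmetric]) (simp_all add: X abc)
  have f2: "exp_map C L p \<cdot> ?f = curry_last X V L B (p \<cdot> f)"
    by (rule curry_last_post_Comp[symmetric]) (simp_all add: X abc)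
  have v2: "exp_restrict C l B \<cdot> curry_last X V L' B c = curry_last X V L B (c \<cdot> (\<one> X \<otimes>\<^sub>m \<one> V \<otimes>\<^sub>m l))"
    by (rule curry_last_restrict[symmetric]) (simp_all add: X abc)
  have "p_hat \<cdot> ?f = q \<cdot> ?v \<longleftrightarrow>
      f \<cdot> (\<one> X \<otimes>\<^sub>m \<one> V \<otimes>\<^sub>m i_L) = b \<and> p \<cdot> f = c \<cdot> (\<one> X \<otimes>\<^sub>m \<one> V \<otimes>\<^sub>m l)"
    by (subst p_hat_eq_iff[where Y = "X \<otimes> V"])
      (simp_all add: f1 f2 v v2 curry_last_eq_iff X abc hom_iff)
  moreover have "?f \<cdot> ?i = curry_last X dV L E a \<longleftrightarrow> f \<cdot> (\<one> X \<otimes>\<^sub>m i_V \<otimes>\<^sub>m \<one> L) = a"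
    unfolding f0 by (rule curry_last_eq_iff) (simp_all add: X abc hom_iff)
  ultimately show ?thesis
    unfolding right_solution_def by (simp add: X abc hom_iff)
qed

lemma glue_eq_iff:
  assumes X: "X \<in> Ob C"
    and "b \<in> hom C (X \<otimes> V \<otimes> dL) E" "c \<in> hom C (X \<otimes> V \<otimes> L') B"
      "p \<cdot> b = c \<cdot> (\<one> X \<otimes>\<^sub>m \<one> V \<otimes>\<^sub>m (l \<cdot> i_L))"
    and "b' \<in> hom C (X \<otimes> V \<otimes> dL) E" "c' \<in> hom C (X \<otimes> V \<otimes> L') B"
      "p \<cdot> b' = c' \<cdot> (\<one> X \<otimes>\<^sub>m \<one> V \<otimes>\<^sub>m (l \<cdot> i_L))"
  shows "glue X b c = glue X b' c' \<longleftrightarrow> b = b' \<and> c = c'"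
  using glue_arr[OF X assms(2-4)] glue_arr[OF X assms(5-7)] X assms(2,3,5,6)
  by (metis E.expo(2,3) exponentiable_Ob curry_last_eq_iff expo_L')

lemma glue_pre_Comp:
  assumes t: "t \<in> hom C Y X" and b: "b \<in> hom C (X \<otimes> V \<otimes> dL) E" and c: "c \<in> hom C (X \<otimes> V \<otimes> L') B"
    and bc: "p \<cdot> b = c \<cdot> (\<one> X \<otimes>\<^sub>m \<one> V \<otimes>\<^sub>m (l \<cdot> i_L))"
  shows "glue Y (b \<cdot> (t \<otimes>\<^sub>m \<one> (V \<otimes> dL))) (c \<cdot> (t \<otimes>\<^sub>m \<one> (V \<otimes> L'))) = glue X b c \<cdot> (t \<otimes>\<^sub>m \<one> V)"
proof -
  have Ob: "X \<in> Ob C" "Y \<in> Ob C" using t by (auto simp: hom_iff)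
  note v = glue_arr[OF Ob(1) b c bc]
  let ?b = "b \<cdot> (t \<otimes>\<^sub>m \<one> (V \<otimes> dL))" and ?c = "c \<cdot> (t \<otimes>\<^sub>m \<one> (V \<otimes> L'))"
  have bc': "?b \<in> hom C (Y \<otimes> V \<otimes> dL) E" "?c \<in> hom C (Y \<otimes> V \<otimes> L') B"
    using t b c Ob by (simp_all add: hom_iff)
  have "p \<cdot> ?b = (p \<cdot> b) \<cdot> (t \<otimes>\<^sub>m \<one> (V \<otimes> dL))"
    using t b Ob by (simp add: hom_iff)
  also have "\<dots> = ?c \<cdot> (\<one> Y \<otimes>\<^sub>m \<one> V \<otimes>\<^sub>m (l \<cdot> i_L))"
    unfolding bc using t c Ob by (simp add: hom_iff)
  finally have eq: "p \<cdot> ?b = \<dots>" .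
  note v' = glue_arr[OF Ob(2) bc' eq]
  show ?thesis
  proof (rule pb_arrow_eqI[of E_leg B_leg'])
    have "pb_proj1 C E_leg B_leg' \<cdot> (glue X b c \<cdot> (t \<otimes>\<^sub>m \<one> V)) = curry_last X V dL E b \<cdot> (t \<otimes>\<^sub>m \<one> V)"
      using Comp_assoc_simp[of "t \<otimes>\<^sub>m \<one> V" "glue X b c" "pb_proj1 C E_leg B_leg'"] v t Ob
      by (simp add: hom_iff)
    then show "pb_proj1 C E_leg B_leg' \<cdot> glue Y ?b ?c = pb_proj1 C E_leg B_leg' \<cdot> (glue X b c \<cdot> (t \<otimes>\<^sub>m \<one> V))"
      using v'(4) curry_last_pre_Comp[of dL t "\<one> V" b Y X V V E] t b Ob by (simp add: hom_iff)
    have "pb_proj2 C E_leg B_leg' \<cdot> (glue X b c \<cdot> (t \<otimes>\<^sub>m \<one> V)) = curry_last X V L' B c \<cdot> (t \<otimes>\<^sub>m \<one> V)"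
      using Comp_assoc_simp[of "t \<otimes>\<^sub>m \<one> V" "glue X b c" "pb_proj2 C E_leg B_leg'"] v t Ob
      by (simp add: hom_iff)
    then show "pb_proj2 C E_leg B_leg' \<cdot> glue Y ?b ?c = pb_proj2 C E_leg B_leg' \<cdot> (glue X b c \<cdot> (t \<otimes>\<^sub>m \<one> V))"
      using v'(5) curry_last_pre_Comp[of L' t "\<one> V" c Y X V V B] t c Ob by (simp add: hom_iff)
  qed (use v v' t Ob in \<open>simp_all add: hom_iff\<close>)
qed

text \<open>The translation of a left problem \<open>(u, c)\<close> into a right problem.\<close>

abbreviation \<alpha> where "\<alpha> X u \<equiv> curry_last X dV L E (E.part1 X u)"
abbreviation \<beta> where "\<beta> X u c \<equiv> glue X (E.part2 X u) c"

abbreviation "left \<equiv> left_problem C k (\<one> V \<otimes>\<^sub>m l) p"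
abbreviation "right \<equiv> right_problem C i_V p_hat q"

lemma part_hom:
  assumes "X \<in> Ob C" "u \<in> hom C (X \<otimes> K) E"
  shows "E.part1 X u \<in> hom C (X \<otimes> dV \<otimes> L) E" "E.part2 X u \<in> hom C (X \<otimes> V \<otimes> dL) E"
  using assms by (simp_all add: hom_iff)

lemma problems_bij:
  "bij_betw (\<lambda>(u, c). (\<alpha> X u, \<beta> X u c)) {(u, c). left X u c} {(u, v). right X u v}"
  unfolding bij_betw_def
proof (intro conjI)
  show "inj_on (\<lambda>(u, c). (\<alpha> X u, \<beta> X u c)) {(u, c). left X u c}"
  proof (rule inj_onI, clarify)
    fix u c u' c'
    assume "left X u c" "left X u' c'" and \<alpha>: "\<alpha> X u = \<alpha> X u'" and \<beta>: "\<beta> X u c = \<beta> X u' c'"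
    then have X: "X \<in> Ob C" and u: "u \<in> hom C (X \<otimes> K) E" and c: "c \<in> hom C (X \<otimes> V \<otimes> L') B"
      and eq: "p \<cdot> E.part2 X u = c \<cdot> (\<one> X \<otimes>\<^sub>m \<one> V \<otimes>\<^sub>m (l \<cdot> i_L))"
      and u': "u' \<in> hom C (X \<otimes> K) E" and c': "c' \<in> hom C (X \<otimes> V \<otimes> L') B"
      and eq': "p \<cdot> E.part2 X u' = c' \<cdot> (\<one> X \<otimes>\<^sub>m \<one> V \<otimes>\<^sub>m (l \<cdot> i_L))"
      by (simp_all add: left_problem_iff)
    have "E.part1 X u = E.part1 X u'"
      using \<alpha> part_hom[OF X u] part_hom[OF X u'] X by (simp add: curry_last_eq_iff)
    moreover have "E.part2 X u = E.part2 X u' \<and> c = c'"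
      using \<beta> glue_eq_iff[OF X part_hom(2)[OF X u] c eq part_hom(2)[OF X u'] c' eq'] by simp
    ultimately show "u = u' \<and> c = c'"
      using E.parts_eq_iff[OF X u u'] by simp
  qed
  show "(\<lambda>(u, c). (\<alpha> X u, \<beta> X u c)) ` {(u, c). left X u c} = {(u, v). right X u v}"
  proof (intro subset_antisym subsetI)
    fix z assume "z \<in> (\<lambda>(u, c). (\<alpha> X u, \<beta> X u c)) ` {(u, c). left X u c}"
    then obtain u c where z: "z = (\<alpha> X u, \<beta> X u c)" and "left X u c" by auto
    then have X: "X \<in> Ob C" and u: "u \<in> hom C (X \<otimes> K) E" and c: "c \<in> hom C (X \<otimes> V \<otimes> L') B"
      and eq: "p \<cdot> E.part1 X u = c \<cdot> (\<one> X \<otimes>\<^sub>m i_V \<otimes>\<^sub>m l)"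
        "p \<cdot> E.part2 X u = c \<cdot> (\<one> X \<otimes>\<^sub>m \<one> V \<otimes>\<^sub>m (l \<cdot> i_L))"
      by (simp_all add: left_problem_iff)
    show "z \<in> {(u, v). right X u v}"
      using right_problem_glue_iff[OF X part_hom[OF X u] c eq(2)] eq(1) E.parts_compatible[OF X u]
      by (simp add: z)
  next
    fix z assume "z \<in> {(u, v). right X u v}"
    then obtain u' v where z: "z = (u', v)" and r: "right X u' v" by auto
    then have X: "X \<in> Ob C" and u': "u' \<in> hom C (X \<otimes> dV) \<lbrakk>L, E\<rbrakk>" and v: "v \<in> hom C (X \<otimes> V) P'"
      by (simp_all add: right_problem_def)
    obtain a where a: "a \<in> hom C (X \<otimes> dV \<otimes> L) E" "curry_last X dV L E a = u'"
      using curry_last_surj[of L X dV E u'] X u' by auto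
    obtain b c where b: "b \<in> hom C (X \<otimes> V \<otimes> dL) E" and c: "c \<in> hom C (X \<otimes> V \<otimes> L') B"
      and bc: "p \<cdot> b = c \<cdot> (\<one> X \<otimes>\<^sub>m \<one> V \<otimes>\<^sub>m (l \<cdot> i_L))" "v = glue X b c"
      using ex_glue[OF X v] by blast
    have ab: "a \<cdot> (\<one> X \<otimes>\<^sub>m \<one> dV \<otimes>\<^sub>m i_L) = b \<cdot> (\<one> X \<otimes>\<^sub>m i_V \<otimes>\<^sub>m \<one> dL)"
      and ac: "p \<cdot> a = c \<cdot> (\<one> X \<otimes>\<^sub>m i_V \<otimes>\<^sub>m l)"
      using r right_problem_glue_iff[OF X a(1) b c bc(1)] a(2) bc(2) by simp_all
    obtain u where u: "u \<in> hom C (X \<otimes> K) E" "E.part1 X u = a" "E.part2 X u = b"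
      using E.ex_parts[OF X a(1) b ab] by blast
    have "left X u c" using X u c bc ac by (simp add: left_problem_iff)
    moreover have "z = (\<alpha> X u, \<beta> X u c)" using z a u bc by simp
    ultimately show "z \<in> (\<lambda>(u, c). (\<alpha> X u, \<beta> X u c)) ` {(u, c). left X u c}" by force
  qed
qed

lemma solutions_bij:
  assumes "left X u c"
  shows "bij_betw (curry_last X V L E) {f. left_solution C k (\<one> V \<otimes>\<^sub>m l) p X u c f}
    {f. right_solution C i_V p_hat q X (\<alpha> X u) (\<beta> X u c) f}"
proof -
  from assms have X: "X \<in> Ob C" and u: "u \<in> hom C (X \<otimes> K) E" and c: "c \<in> hom C (X \<otimes> V \<otimes> L') B"
    and eq: "p \<cdot> E.part2 X u = c \<cdot> (\<one> X \<otimes>\<^sub>m \<one> V \<otimes>\<^sub>m (l \<cdot> i_L))"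
    by (simp_all add: left_problem_iff)
  let ?S = "{f \<in> hom C (X \<otimes> V \<otimes> L) E. left_solution C k (\<one> V \<otimes>\<^sub>m l) p X u c f}"
  have iff: "right_solution C i_V p_hat q X (\<alpha> X u) (\<beta> X u c) (curry_last X V L E f) \<longleftrightarrow>
      left_solution C k (\<one> V \<otimes>\<^sub>m l) p X u c f" if "f \<in> hom C (X \<otimes> V \<otimes> L) E" for f
    using right_solution_glue_iff[OF X part_hom[OF X u] c eq that] left_solution_iff[OF X u] that
    by simp
  have bij: "bij_betw (curry_last X V L E) (hom C (X \<otimes> V \<otimes> L) E) (hom C (X \<otimes> V) \<lbrakk>L, E\<rbrakk>)"
    by (rule curry_last_bij) (simp_all add: X)
  have "bij_betw (curry_last X V L E) ?S
      {g \<in> hom C (X \<otimes> V) \<lbrakk>L, E\<rbrakk>. right_solution C i_V p_hat q X (\<alpha> X u) (\<beta> X u c) g}"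
    by (rule bij_betw_Collect[OF bij]) (rule iff)
  moreover have "?S = {f. left_solution C k (\<one> V \<otimes>\<^sub>m l) p X u c f}"
    by (auto simp: left_solution_def)
  moreover have "{g \<in> hom C (X \<otimes> V) \<lbrakk>L, E\<rbrakk>. right_solution C i_V p_hat q X (\<alpha> X u) (\<beta> X u c) g} =
      {g. right_solution C i_V p_hat q X (\<alpha> X u) (\<beta> X u c) g}"
    by (auto simp: right_solution_def)
  ultimately show ?thesis by simp
qed

lemma left_problem_pre_Comp:
  assumes "left X u c" "t \<in> hom C Y X"
  shows "left Y (u \<cdot> (t \<otimes>\<^sub>m \<one> K)) (c \<cdot> (t \<otimes>\<^sub>m \<one> (V \<otimes> L')))"
proof -
  have Ob: "X \<in> Ob C" "Y \<in> Ob C" using assms(2) by (auto simp: hom_iff)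
  have uc: "u \<in> hom C (X \<otimes> K) E" "c \<in> hom C (X \<otimes> V \<otimes> L') B"
    and eq: "p \<cdot> u = c \<cdot> (\<one> X \<otimes>\<^sub>m \<one> V \<otimes>\<^sub>m l) \<cdot> (\<one> X \<otimes>\<^sub>m k)"
    using assms(1) by (simp_all add: left_problem_def)
  have "p \<cdot> (u \<cdot> (t \<otimes>\<^sub>m \<one> K)) = (p \<cdot> u) \<cdot> (t \<otimes>\<^sub>m \<one> K)"
    using uc assms(2) Ob by (simp add: hom_iff)
  then show ?thesis
    unfolding left_problem_def eq using uc assms(2) Ob by (simp add: hom_iff)
qed

lemma left_solution_pre_Comp:
  assumes "left X u c" "left_solution C k (\<one> V \<otimes>\<^sub>m l) p X u c f" "t \<in> hom C Y X"
  shows "left_solution C k (\<one> V \<otimes>\<^sub>m l) p Y (u \<cdot> (t \<otimes>\<^sub>m \<one> K)) (c \<cdot> (t \<otimes>\<^sub>m \<one> (V \<otimes> L')))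
    (f \<cdot> (t \<otimes>\<^sub>m \<one> (V \<otimes> L)))"
proof -
  have Ob: "X \<in> Ob C" "Y \<in> Ob C" using assms(3) by (auto simp: hom_iff)
  have c: "c \<in> hom C (X \<otimes> V \<otimes> L') B" and f: "f \<in> hom C (X \<otimes> V \<otimes> L) E"
    and u: "u = f \<cdot> (\<one> X \<otimes>\<^sub>m k)" and pf: "p \<cdot> f = c \<cdot> (\<one> X \<otimes>\<^sub>m \<one> V \<otimes>\<^sub>m l)"
    using assms(1,2) by (simp_all add: left_problem_def left_solution_def)
  have "p \<cdot> (f \<cdot> (t \<otimes>\<^sub>m \<one> (V \<otimes> L))) = (p \<cdot> f) \<cdot> (t \<otimes>\<^sub>m \<one> (V \<otimes> L))"
    using f assms(3) Ob by (simp add: hom_iff)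
  then show ?thesis
    unfolding left_solution_def u pf using f c assms(3) Ob by (simp add: hom_iff)
qed

theorem Lift_L_bij_Lift_R:
  "\<exists>\<Phi>. bij_betw \<Phi> (Lift_L C k (\<one> V \<otimes>\<^sub>m l) p) (Lift_R C i_V p_hat q)"
proof -
  have L: "Lift_L C k (\<one> V \<otimes>\<^sub>m l) p = uniform_solutions left (left_solution C k (\<one> V \<otimes>\<^sub>m l) p) (hom C)
      (\<lambda>t u. u \<cdot> (t \<otimes>\<^sub>m \<one> K)) (\<lambda>t c. c \<cdot> (t \<otimes>\<^sub>m \<one> (V \<otimes> L'))) (\<lambda>t f. f \<cdot> (t \<otimes>\<^sub>m \<one> (V \<otimes> L)))"
    unfolding Lift_L_def uniform_solutions_def by simp
  have R: "Lift_R C i_V p_hat q = uniform_solutions right (right_solution C i_V p_hat q) (hom C)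
      (\<lambda>t u. u \<cdot> (t \<otimes>\<^sub>m \<one> dV)) (\<lambda>t v. v \<cdot> (t \<otimes>\<^sub>m \<one> V)) (\<lambda>t f. f \<cdot> (t \<otimes>\<^sub>m \<one> V))"
    unfolding Lift_R_def uniform_solutions_def by simp
  show ?thesis
    unfolding L R
  proof (rule uniform_solutions_bij[where \<alpha> = \<alpha> and \<beta> = \<beta> and \<gamma> = "\<lambda>X. curry_last X V L E"])
    fix X Y u c t assume *: "left X u c" and t: "t \<in> hom C Y X"
    have Ob: "X \<in> Ob C" "Y \<in> Ob C" using t by (auto simp: hom_iff)
    have u: "u \<in> hom C (X \<otimes> K) E" and c: "c \<in> hom C (X \<otimes> V \<otimes> L') B"
      and eq: "p \<cdot> E.part2 X u = c \<cdot> (\<one> X \<otimes>\<^sub>m \<one> V \<otimes>\<^sub>m (l \<cdot> i_L))"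
      using * by (simp_all add: left_problem_iff)
    show "\<alpha> Y (u \<cdot> (t \<otimes>\<^sub>m \<one> K)) = \<alpha> X u \<cdot> (t \<otimes>\<^sub>m \<one> dV)"
      using curry_last_pre_Comp[of L t "\<one> dV" "E.part1 X u" Y X dV dV E] t u Ob
      by (simp add: E.parts_pre_Comp[OF t u] hom_iff)
    show "\<beta> Y (u \<cdot> (t \<otimes>\<^sub>m \<one> K)) (c \<cdot> (t \<otimes>\<^sub>m \<one> (V \<otimes> L'))) = \<beta> X u c \<cdot> (t \<otimes>\<^sub>m \<one> V)"
      unfolding E.parts_pre_Comp[OF t u] by (rule glue_pre_Comp[OF t part_hom(2)[OF Ob(1) u] c eq])
    fix f assume "left_solution C k (\<one> V \<otimes>\<^sub>m l) p X u c f"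
    then have f: "f \<in> hom C (X \<otimes> V \<otimes> L) E" by (simp add: left_solution_def)
    show "curry_last Y V L E (f \<cdot> (t \<otimes>\<^sub>m \<one> (V \<otimes> L))) = curry_last X V L E f \<cdot> (t \<otimes>\<^sub>m \<one> V)"
      using curry_last_pre_Comp[of L t "\<one> V" f Y X V V E] t f Ob by (simp add: hom_iff)
  qed (fact problems_bij solutions_bij left_problem_pre_Comp left_solution_pre_Comp)+
qed

end

theorem theorem5p1:
  fixes C :: "('o, 'm) category" (structure)
    and dV V dL L L' K E B :: 'o
    and i_V i_L p l k s_E s_B :: 'm
  assumes "category C"
    and "finitely_complete C"
    and "i_V \<in> hom C dV V" and "i_L \<in> hom C dL L"
    and "p \<in> hom C E B" and "l \<in> hom C L L'"
    and "exponentiable C dV" and "exponentiable C V"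
    and "exponentiable C dL" and "exponentiable C L" and "exponentiable C L'"
    and "exponentiable C K" and "k \<in> hom C K (prod_ob C V L)"
    and "approximation_structure C i_V i_L p k s_E s_B"
    and restriction_at_E: "s_E \<cdot> M_restrict C i_V i_L E = exp_restrict C k E"
  shows "\<exists>\<Phi>. bij_betw \<Phi>
    (Lift_L C k (prod_map C (\<one> V) l) p)
    (Lift_R C i_V (pullback_power C i_L p) (power_restrict C i_L l p))"
proof -
  interpret category C by fact
  have maps: "p \<in> Arr C" "Dom C p = E" "Cod C p = B" "Dom C k = K"
    using assms by (simp_all add: hom_iff)
  then have Ob: "E \<in> Ob C" "B \<in> Ob C" by auto
  interpret pushout_product_approximation C dV V dL L K E B i_V i_L k s_E s_B L' p l
    using assms maps Ob by unfold_locales (simp_all add: approximation_structure_def)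
  show ?thesis by (rule Lift_L_bij_Lift_R)
qed

end
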